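(* Let $\mathcal{V}$ be a complex vector space, let $\Xi\subset\mathcal{V}_{nc}$ be a full nc subset, and let $\mathbf{A}$ be an algebra of nc functions from $\Xi$ into $\mathbb{C}_{nc}$ which contains the identity function $x\in\Xi_n\mapsto I_n$. Let $\mathbb{D}_Q\subset\Xi$ be a basic $\mathbf{A}$-free open set and let $f:\mathbb{D}_Q\to\mathbb{M}^1$ be a bounded graded function. Then the following conditions are equivalent: (1) $f$ is an nc function, i.e. $f\in H^{\infty}(\mathbb{D}_Q)$. (2) For every $\lambda\in\mathbb{D}_Q$ there exists $p\in\mathbf{A}$ such that $f(x)=p(x)$ for all $x\in V_\lambda\cap\mathbb{D}_Q$. (3) For each nc subset $K$ of $\mathbb{D}_Q$ that is compact in the $\mathbf{A}$-free topology, there exists $p\in\mathbf{A}$ such that $f(x)=p(x)$ for all $x\in K$.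
   Context: Nc sets and functions. For a complex vector space $\mathcal{V}$, $\mathcal{V}^{m\times n}$ denotes the $m\times n$ matrices over $\mathcal{V}$, and $\mathcal{V}_{nc}=\coprod_{n\ge 1}\mathcal{V}^{n\times n}$. Complex matrices act on matrices over $\mathcal{V}$ from the left and right by the usual matrix multiplication. For $\Omega\subset\mathcal{V}_{nc}$, put $\Omega_n=\Omega\cap\mathcal{V}^{n\times n}$. $\Omega$ is an nc set if $x\in\Omega_n$, $y\in\Omega_m$ imply $x\oplus y=\begin{bmatrix}x&0\\0&y\end{bmatrix}\in\Omega_{n+m}$. A function $f:\Omega\to\mathcal{V}_{0,nc}$ ($\mathcal{V}_0$ a complex vector space) is graded if $f(x)\in\mathcal{V}_0^{n\times n}$ for $x\in\Omega_n$. A function $f$ on an nc set $\Omega$ is an nc function if it is graded and respects intertwinings: whenever $x\in\Omega_n$, $y\in\Omega_m$, $\alpha\in\mathbb{C}^{m\times n}$ satisfy $\alpha x=y\alpha$, then $\alpha f(x)=f(y)\alpha$. We write $\mathbb{M}^1=\mathbb{C}_{nc}=\coprod_{n\ge1}\mathbb{C}^{n\times n}$. Full nc set. An nc set $\Xi\subset\mathcal{V}_{nc}$ is a full nc subset if whenever $x\in\Xi_n$, $y\in\mathcal{V}^{m\times m}$ and $Iy=xI$ for some injective $I\in\mathbb{C}^{n\times m}$, then $y\in\Xi_m$. $\mathbf{A}$-free topology. $\mathbf{A}$ is an algebra (under pointwise operations) of nc functions $\Xi\to\mathbb{C}_{nc}$. For a finite-size $s\times r$ matrix $Q=[q_{ij}]$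 with entries in $\mathbf{A}$, and $z\in\Xi_n$, $Q(z)=[q_{ij}(z)]$ is viewed as a complex $sn\times rn$ matrix, and $\|Q(z)\|$ is its operator norm. The basic $\mathbf{A}$-free open sets are the nc sets $\mathbb{D}_Q=\{z\in\Xi : \|Q(z)\|<1\}$; they form a base of a topology on $\Xi$, called the $\mathbf{A}$-free topology. Compactness is in the sense of open covers (the topology need not be Hausdorff). Bounded functions. A graded function $f:\mathbb{D}_Q\to\mathbb{M}^1$ is bounded if $\sup_{z\in\mathbb{D}_Q}\|f(z)\|<\infty$ (operator norm). $H^\infty(\mathbb{D}_Q)$ is the set of bounded nc functions $\mathbb{D}_Q\to\mathbb{M}^1$. $\mathbf{A}$-Zariski closure of a point. For $\lambda\in\Xi$, $I_\lambda=\{p\in\mathbf{A} : p(\lambda)=0\}$ and $V_\lambda=\{x\in\Xi : p(x)=0\text{ for all }p\in I_\lambda\}$. *)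

theory Defs
  imports "HOL-Analysis.Abstract_Topology" "HOL-Analysis.L2_Norm" "HOL-Library.FuncSet"
    "Jordan_Normal_Form.Matrix"
begin

section \<open>Noncommutative sets\<close>

text \<open>
  A complex vector space is a type \<open>'v\<close> together with a scalar multiplication \<open>scale\<close> such that
  \<open>vector_space scale\<close>. The type of matrices contains matrices with no rows or columns;
  the levels of an nc space start at 1, so these are excluded.
\<close>

definition nc_space :: "'v mat set" where
  "nc_space = {x. square_mat x \<and> 0 < dim_row x}"

definition nc_level :: "'v mat set \<Rightarrow> nat \<Rightarrow> 'v mat set" where
  "nc_level \<Omega> n = \<Omega> \<inter> carrier_mat n n"

definition left_act :: "(complex \<Rightarrow> 'v \<Rightarrow> 'v) \<Rightarrow> complex mat \<Rightarrow> 'v::comm_monoid_add mat \<Rightarrow> 'v mat" where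
  "left_act scale \<alpha> x =
     mat (dim_row \<alpha>) (dim_col x) (\<lambda>(i, j). \<Sum>k<dim_row x. scale (\<alpha> $$ (i, k)) (x $$ (k, j)))"

definition right_act :: "(complex \<Rightarrow> 'v \<Rightarrow> 'v) \<Rightarrow> 'v::comm_monoid_add mat \<Rightarrow> complex mat \<Rightarrow> 'v mat" where
  "right_act scale x \<alpha> =
     mat (dim_row x) (dim_col \<alpha>) (\<lambda>(i, j). \<Sum>k<dim_col x. scale (\<alpha> $$ (k, j)) (x $$ (i, k)))"

definition direct_sum_mat :: "'v::zero mat \<Rightarrow> 'v mat \<Rightarrow> 'v mat" where
  "direct_sum_mat x y =
     four_block_mat x (0\<^sub>m (dim_row x) (dim_col y)) (0\<^sub>m (dim_row y) (dim_col x)) y"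

definition nc_set :: "'v::zero mat set \<Rightarrow> bool" where
  "nc_set \<Omega> \<longleftrightarrow> \<Omega> \<subseteq> nc_space \<and> (\<forall>x\<in>\<Omega>. \<forall>y\<in>\<Omega>. direct_sum_mat x y \<in> \<Omega>)"

definition full_nc_set :: "(complex \<Rightarrow> 'v \<Rightarrow> 'v) \<Rightarrow> 'v::comm_monoid_add mat set \<Rightarrow> bool" where
  "full_nc_set scale \<Xi> \<longleftrightarrow> nc_set \<Xi> \<and>
     (\<forall>n m. \<forall>x\<in>nc_level \<Xi> n. \<forall>y\<in>nc_level nc_space m. \<forall>J\<in>carrier_mat n m.
        inj_on ((*\<^sub>v) J) (carrier_vec m) \<longrightarrow> left_act scale J y = right_act scale x J
          \<longrightarrow> y \<in> nc_level \<Xi> m)"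

section \<open>Noncommutative functions with values in the complex nc space\<close>

definition graded_on :: "'v mat set \<Rightarrow> ('v mat \<Rightarrow> complex mat) \<Rightarrow> bool" where
  "graded_on \<Omega> f \<longleftrightarrow> (\<forall>n. \<forall>x\<in>nc_level \<Omega> n. f x \<in> carrier_mat n n)"

definition nc_function ::
  "(complex \<Rightarrow> 'v \<Rightarrow> 'v) \<Rightarrow> 'v::comm_monoid_add mat set \<Rightarrow> ('v mat \<Rightarrow> complex mat) \<Rightarrow> bool" where
  "nc_function scale \<Omega> f \<longleftrightarrow> graded_on \<Omega> f \<and>
     (\<forall>n m. \<forall>x\<in>nc_level \<Omega> n. \<forall>y\<in>nc_level \<Omega> m. \<forall>\<alpha>\<in>carrier_mat m n.
        left_act scale \<alpha> x = right_act scale y \<alpha> \<longrightarrow> \<alpha> * f x = f y * \<alpha>)"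

text \<open>
  Functions on \<open>\<Xi>\<close> are represented by total functions that are \<open>undefined\<close> off \<open>\<Xi>\<close>,
  so that equality in the algebra is equality on \<open>\<Xi>\<close>.
\<close>

definition nc_zero :: "'v mat set \<Rightarrow> 'v mat \<Rightarrow> complex mat" where
  "nc_zero \<Xi> = (\<lambda>x\<in>\<Xi>. 0\<^sub>m (dim_row x) (dim_row x))"

definition nc_unit :: "'v mat set \<Rightarrow> 'v mat \<Rightarrow> complex mat" where
  "nc_unit \<Xi> = (\<lambda>x\<in>\<Xi>. 1\<^sub>m (dim_row x))"

definition nc_algebra ::
  "(complex \<Rightarrow> 'v \<Rightarrow> 'v) \<Rightarrow> 'v::comm_monoid_add mat set \<Rightarrow> ('v mat \<Rightarrow> complex mat) set \<Rightarrow> bool" where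
  "nc_algebra scale \<Xi> A \<longleftrightarrow> A \<subseteq> extensional \<Xi> \<and> (\<forall>p\<in>A. nc_function scale \<Xi> p) \<and>
     nc_zero \<Xi> \<in> A \<and>
     (\<forall>p\<in>A. \<forall>q\<in>A. (\<lambda>x\<in>\<Xi>. p x + q x) \<in> A) \<and>
     (\<forall>c. \<forall>p\<in>A. (\<lambda>x\<in>\<Xi>. c \<cdot>\<^sub>m p x) \<in> A) \<and>
     (\<forall>p\<in>A. \<forall>q\<in>A. (\<lambda>x\<in>\<Xi>. p x * q x) \<in> A)"

section \<open>Operator norm and boundedness\<close>

definition l2_norm_vec :: "complex vec \<Rightarrow> real" where
  "l2_norm_vec v = L2_set (\<lambda>i. cmod (v $ i)) {..<dim_vec v}"

definition op_norm_mat :: "complex mat \<Rightarrow> real" where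
  "op_norm_mat A = (SUP v\<in>{v \<in> carrier_vec (dim_col A). l2_norm_vec v \<le> 1}. l2_norm_vec (A *\<^sub>v v))"

definition bounded_graded :: "'v mat set \<Rightarrow> ('v mat \<Rightarrow> complex mat) \<Rightarrow> bool" where
  "bounded_graded \<Omega> f \<longleftrightarrow> graded_on \<Omega> f \<and> bdd_above ((\<lambda>z. op_norm_mat (f z)) ` \<Omega>)"

definition H_infty ::
  "(complex \<Rightarrow> 'v \<Rightarrow> 'v) \<Rightarrow> 'v::comm_monoid_add mat set \<Rightarrow> ('v mat \<Rightarrow> complex mat) set" where
  "H_infty scale \<Omega> = {f. nc_function scale \<Omega> f \<and> bounded_graded \<Omega> f}"

section \<open>Zariski closure of a point\<close>

definition vanishing_ideal ::
  "('v mat \<Rightarrow> complex mat) set \<Rightarrow> 'v mat \<Rightarrow> ('v mat \<Rightarrow> complex mat) set" where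
  "vanishing_ideal A l = {p \<in> A. p l = 0\<^sub>m (dim_row l) (dim_row l)}"

definition zariski_closure ::
  "'v mat set \<Rightarrow> ('v mat \<Rightarrow> complex mat) set \<Rightarrow> 'v mat \<Rightarrow> 'v mat set" where
  "zariski_closure \<Xi> A l = {x \<in> \<Xi>. \<forall>p\<in>vanishing_ideal A l. p x = 0\<^sub>m (dim_row x) (dim_row x)}"

section \<open>The free topology of an algebra\<close>

definition matrix_over ::
  "('v mat \<Rightarrow> complex mat) set \<Rightarrow> ('v mat \<Rightarrow> complex mat) mat \<Rightarrow> bool" where
  "matrix_over A Q \<longleftrightarrow> 0 < dim_row Q \<and> 0 < dim_col Q \<and> elements_mat Q \<subseteq> A"

text \<open>
  For \<open>Q\<close> of size \<open>s \<times> r\<close> and \<open>z\<close> of size \<open>n \<times> n\<close>, this is the \<open>sn \<times> rn\<close> matrix whose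
  \<open>n \<times> n\<close> block in position \<open>(i, j)\<close> is the value at \<open>z\<close> of the entry \<open>(i, j)\<close> of \<open>Q\<close>.
\<close>

definition eval_matrix :: "('v mat \<Rightarrow> complex mat) mat \<Rightarrow> 'v mat \<Rightarrow> complex mat" where
  "eval_matrix Q z = (let n = dim_row z in
     mat (dim_row Q * n) (dim_col Q * n)
       (\<lambda>(i, j). ((Q $$ (i div n, j div n)) z) $$ (i mod n, j mod n)))"

definition basic_free_set :: "'v mat set \<Rightarrow> ('v mat \<Rightarrow> complex mat) mat \<Rightarrow> 'v mat set" where
  "basic_free_set \<Xi> Q = {z \<in> \<Xi>. op_norm_mat (eval_matrix Q z) < 1}"

definition free_topology :: "'v mat set \<Rightarrow> ('v mat \<Rightarrow> complex mat) set \<Rightarrow> 'v mat topology" where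
  "free_topology \<Xi> A =
     topology (arbitrary union_of (\<lambda>U. \<exists>Q. matrix_over A Q \<and> U = basic_free_set \<Xi> Q))"

section \<open>The basic free sets form a base\<close>

text \<open>
  The constant \<^const>\<open>topology\<close> is only meaningful on families satisfying \<^const>\<open>istopology\<close>.
  Since the norm of a direct sum is the maximum of the norms, the basic free sets are closed under
  intersection, so their unions do form a topology.
\<close>

lemma l2_norm_vec_nonneg: "0 \<le> l2_norm_vec v"
  by (simp add: l2_norm_vec_def L2_set_nonneg)

lemma l2_norm_vec_sq: "(l2_norm_vec v)\<^sup>2 = (\<Sum>i<dim_vec v. (cmod (v $ i))\<^sup>2)"
  by (simp add: l2_norm_vec_def L2_set_def sum_nonneg)

lemma l2_norm_vec_smult: "l2_norm_vec (c \<cdot>\<^sub>v v) = cmod c * l2_norm_vec v"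
proof -
  have "l2_norm_vec (c \<cdot>\<^sub>v v) = L2_set (\<lambda>i. cmod c * cmod (v $ i)) {..<dim_vec v}"
    unfolding l2_norm_vec_def by (intro L2_set_cong) (auto simp: norm_mult)
  then show ?thesis by (simp add: L2_set_right_distrib l2_norm_vec_def)
qed

lemma l2_norm_vec_append: "(l2_norm_vec (v @\<^sub>v w))\<^sup>2 = (l2_norm_vec v)\<^sup>2 + (l2_norm_vec w)\<^sup>2"
proof -
  have "(\<Sum>i<m + k. g i) = (\<Sum>i<m. g i) + (\<Sum>i<k. g (m + i))" for g :: "nat \<Rightarrow> real" and m k
    by (induction k) simp_all
  then show ?thesis by (simp add: l2_norm_vec_sq)
qed

lemma l2_norm_vec_zero: "l2_norm_vec (0\<^sub>v n) = 0"
  by (simp add: l2_norm_vec_def L2_set_def)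

lemma op_norm_mat_bdd_above:
  "bdd_above ((\<lambda>v. l2_norm_vec (A *\<^sub>v v)) ` {v \<in> carrier_vec (dim_col A). l2_norm_vec v \<le> 1})"
proof (rule bdd_aboveI2)
  fix v assume "v \<in> {v \<in> carrier_vec (dim_col A). l2_norm_vec v \<le> 1}"
  then have v: "dim_vec v = dim_col A" "l2_norm_vec v \<le> 1" by auto
  have le1: "cmod (v $ j) \<le> 1" if "j < dim_col A" for j
    using v(2) member_le_L2_set[of "{..<dim_vec v}" j "\<lambda>i. cmod (v $ i)"] that v(1)
    by (simp add: l2_norm_vec_def)
  have "l2_norm_vec (A *\<^sub>v v) \<le> (\<Sum>i<dim_row A. cmod ((A *\<^sub>v v) $ i))"
    using L2_set_le_sum[of "{..<dim_row A}" "\<lambda>i. cmod ((A *\<^sub>v v) $ i)"]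
    by (simp add: l2_norm_vec_def)
  also have "\<dots> \<le> (\<Sum>i<dim_row A. \<Sum>j<dim_col A. cmod (A $$ (i, j)))"
  proof (rule sum_mono)
    fix i assume "i \<in> {..<dim_row A}"
    then have "cmod ((A *\<^sub>v v) $ i) = cmod (\<Sum>j<dim_col A. A $$ (i, j) * v $ j)"
      by (simp add: scalar_prod_def v(1) atLeast0LessThan)
    also have "\<dots> \<le> (\<Sum>j<dim_col A. cmod (A $$ (i, j)))"
      by (rule sum_norm_le) (auto simp: norm_mult intro!: mult_left_le le1)
    finally show "cmod ((A *\<^sub>v v) $ i) \<le> (\<Sum>j<dim_col A. cmod (A $$ (i, j)))" .
  qed
  finally show "l2_norm_vec (A *\<^sub>v v) \<le> (\<Sum>i<dim_row A. \<Sum>j<dim_col A. cmod (A $$ (i, j)))" .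
qed

lemma op_norm_mat_upper:
  assumes "v \<in> carrier_vec (dim_col A)" "l2_norm_vec v \<le> 1"
  shows "l2_norm_vec (A *\<^sub>v v) \<le> op_norm_mat A"
  unfolding op_norm_mat_def by (rule cSUP_upper[OF _ op_norm_mat_bdd_above]) (use assms in auto)

lemma op_norm_mat_le:
  assumes "\<And>v. v \<in> carrier_vec (dim_col A) \<Longrightarrow> l2_norm_vec v \<le> 1 \<Longrightarrow> l2_norm_vec (A *\<^sub>v v) \<le> c"
  shows "op_norm_mat A \<le> c"
proof -
  have "0\<^sub>v (dim_col A) \<in> {v \<in> carrier_vec (dim_col A). l2_norm_vec v \<le> 1}"
    by (simp add: l2_norm_vec_zero)
  then have ne: "{v \<in> carrier_vec (dim_col A). l2_norm_vec v \<le> 1} \<noteq> {}" by blast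
  show ?thesis
    unfolding op_norm_mat_def by (rule cSUP_least[OF ne]) (use assms in auto)
qed

lemma op_norm_mat_nonneg: "0 \<le> op_norm_mat A"
  using op_norm_mat_upper[of "0\<^sub>v (dim_col A)" A] l2_norm_vec_nonneg[of "A *\<^sub>v 0\<^sub>v (dim_col A)"]
  by (simp add: l2_norm_vec_zero)

lemma op_norm_mat_bound:
  assumes v: "v \<in> carrier_vec (dim_col A)"
  shows "l2_norm_vec (A *\<^sub>v v) \<le> op_norm_mat A * l2_norm_vec v"
proof (cases "l2_norm_vec v = 0")
  case True
  have "l2_norm_vec (A *\<^sub>v v) \<le> 0"
  proof (rule ccontr)
    assume pos: "\<not> l2_norm_vec (A *\<^sub>v v) \<le> 0"
    define t where "t = (op_norm_mat A + 1) / l2_norm_vec (A *\<^sub>v v)"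
    have "l2_norm_vec (A *\<^sub>v (complex_of_real t \<cdot>\<^sub>v v)) \<le> op_norm_mat A"
      by (rule op_norm_mat_upper) (use v True in \<open>auto simp: l2_norm_vec_smult\<close>)
    then have "l2_norm_vec (complex_of_real t \<cdot>\<^sub>v (A *\<^sub>v v)) \<le> op_norm_mat A"
      by (simp only: mult_mat_vec[OF carrier_matI[OF refl refl] v])
    moreover have "cmod (complex_of_real t) * l2_norm_vec (A *\<^sub>v v) = op_norm_mat A + 1"
      unfolding norm_of_real using pos op_norm_mat_nonneg[of A] by (simp add: t_def)
    ultimately show False using l2_norm_vec_smult[of "complex_of_real t" "A *\<^sub>v v"] by linarith
  qed
  then show ?thesis using True by simp
next
  case False
  then have pos: "l2_norm_vec v > 0" using l2_norm_vec_nonneg[of v] by simp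
  define c where "c = complex_of_real (1 / l2_norm_vec v)"
  have c: "cmod c = 1 / l2_norm_vec v"
    unfolding c_def norm_of_real using pos by simp
  have "l2_norm_vec (A *\<^sub>v (c \<cdot>\<^sub>v v)) \<le> op_norm_mat A"
    by (rule op_norm_mat_upper) (use v pos c in \<open>auto simp: l2_norm_vec_smult\<close>)
  moreover have "A *\<^sub>v (c \<cdot>\<^sub>v v) = c \<cdot>\<^sub>v (A *\<^sub>v v)"
    by (rule mult_mat_vec[OF _ v]) auto
  ultimately show ?thesis using pos c by (simp add: l2_norm_vec_smult field_simps)
qed

lemma direct_sum_mat_mult_append:
  fixes A B :: "complex mat"
  assumes v: "v \<in> carrier_vec (dim_col A)" and w: "w \<in> carrier_vec (dim_col B)"
  shows "direct_sum_mat A B *\<^sub>v (v @\<^sub>v w) = (A *\<^sub>v v) @\<^sub>v (B *\<^sub>v w)"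
  unfolding direct_sum_mat_def
proof (subst four_block_mat_mult_vec[OF _ zero_carrier_mat zero_carrier_mat _ v w])
  show "(A *\<^sub>v v + 0\<^sub>m (dim_row A) (dim_col B) *\<^sub>v w) @\<^sub>v (0\<^sub>m (dim_row B) (dim_col A) *\<^sub>v v + B *\<^sub>v w)
      = A *\<^sub>v v @\<^sub>v B *\<^sub>v w"
    using v w by (intro arg_cong2[where f = append_vec] eq_vecI) auto
qed auto

lemma op_norm_mat_direct_sum: 
  "op_norm_mat (direct_sum_mat A B) = max (op_norm_mat A) (op_norm_mat B)"
proof (rule antisym)
  let ?m = "max (op_norm_mat A) (op_norm_mat B)"
  have cd: "dim_col (direct_sum_mat A B) = dim_col A + dim_col B" by (simp add: direct_sum_mat_def)
  show "op_norm_mat (direct_sum_mat A B) \<le> ?m"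
  proof (rule op_norm_mat_le)
    fix u assume u: "u \<in> carrier_vec (dim_col (direct_sum_mat A B))" "l2_norm_vec u \<le> 1"
    define v where "v = vec_first u (dim_col A)"
    define w where "w = vec_last u (dim_col B)"
    have u_eq: "u = v @\<^sub>v w" and v: "v \<in> carrier_vec (dim_col A)" and w: "w \<in> carrier_vec (dim_col B)"
      using u(1) by (simp_all add: v_def w_def cd)
    have m: "0 \<le> ?m" using op_norm_mat_nonneg[of A] by simp
    have "l2_norm_vec (A *\<^sub>v v) \<le> ?m * l2_norm_vec v"
      by (rule order_trans[OF op_norm_mat_bound[OF v]]) (intro mult_right_mono l2_norm_vec_nonneg, simp)
    moreover have "l2_norm_vec (B *\<^sub>v w) \<le> ?m * l2_norm_vec w"
      by (rule order_trans[OF op_norm_mat_bound[OF w]]) (intro mult_right_mono l2_norm_vec_nonneg, simp)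
    ultimately have "(l2_norm_vec (A *\<^sub>v v))\<^sup>2 + (l2_norm_vec (B *\<^sub>v w))\<^sup>2
        \<le> (?m * l2_norm_vec v)\<^sup>2 + (?m * l2_norm_vec w)\<^sup>2"
      by (intro add_mono power_mono l2_norm_vec_nonneg)
    also have "\<dots> = (?m * l2_norm_vec u)\<^sup>2"
      by (simp add: u_eq l2_norm_vec_append power_mult_distrib distrib_left)
    finally have "(l2_norm_vec (direct_sum_mat A B *\<^sub>v u))\<^sup>2 \<le> (?m * l2_norm_vec u)\<^sup>2"
      by (simp add: u_eq direct_sum_mat_mult_append[OF v w] l2_norm_vec_append)
    then have "l2_norm_vec (direct_sum_mat A B *\<^sub>v u) \<le> ?m * l2_norm_vec u"
      by (rule power2_le_imp_le) (intro mult_nonneg_nonneg m l2_norm_vec_nonneg)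
    also have "\<dots> \<le> ?m" by (rule mult_left_le[OF u(2) m])
    finally show "l2_norm_vec (direct_sum_mat A B *\<^sub>v u) \<le> ?m" .
  qed
  have sq: "l2_norm_vec v \<le> l2_norm_vec (v @\<^sub>v w)" "l2_norm_vec w \<le> l2_norm_vec (v @\<^sub>v w)" for v w
    by (rule power2_le_imp_le, simp add: l2_norm_vec_append, rule l2_norm_vec_nonneg)+
  have z: "l2_norm_vec (v @\<^sub>v 0\<^sub>v k) = l2_norm_vec v" "l2_norm_vec (0\<^sub>v k @\<^sub>v v) = l2_norm_vec v" for v k
    by (rule power2_eq_imp_eq, simp add: l2_norm_vec_append l2_norm_vec_zero,
        (rule l2_norm_vec_nonneg)+)+
  have "op_norm_mat A \<le> op_norm_mat (direct_sum_mat A B)"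
  proof (rule op_norm_mat_le)
    fix v assume v: "v \<in> carrier_vec (dim_col A)" "l2_norm_vec v \<le> 1"
    have "l2_norm_vec (direct_sum_mat A B *\<^sub>v (v @\<^sub>v 0\<^sub>v (dim_col B))) \<le> op_norm_mat (direct_sum_mat A B)"
      by (rule op_norm_mat_upper) (use v in \<open>auto simp: cd z\<close>)
    then have "l2_norm_vec ((A *\<^sub>v v) @\<^sub>v (B *\<^sub>v 0\<^sub>v (dim_col B))) \<le> op_norm_mat (direct_sum_mat A B)"
      by (simp only: direct_sum_mat_mult_append[OF v(1) zero_carrier_vec])
    with sq(1) show "l2_norm_vec (A *\<^sub>v v) \<le> op_norm_mat (direct_sum_mat A B)"
      by (rule order_trans)
  qed
  moreover have "op_norm_mat B \<le> op_norm_mat (direct_sum_mat A B)"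
  proof (rule op_norm_mat_le)
    fix v assume v: "v \<in> carrier_vec (dim_col B)" "l2_norm_vec v \<le> 1"
    have "l2_norm_vec (direct_sum_mat A B *\<^sub>v (0\<^sub>v (dim_col A) @\<^sub>v v)) \<le> op_norm_mat (direct_sum_mat A B)"
      by (rule op_norm_mat_upper) (use v in \<open>auto simp: cd z\<close>)
    then have "l2_norm_vec ((A *\<^sub>v 0\<^sub>v (dim_col A)) @\<^sub>v (B *\<^sub>v v)) \<le> op_norm_mat (direct_sum_mat A B)"
      by (simp only: direct_sum_mat_mult_append[OF zero_carrier_vec v(1)])
    with sq(2) show "l2_norm_vec (B *\<^sub>v v) \<le> op_norm_mat (direct_sum_mat A B)"
      by (rule order_trans)
  qed
  ultimately show "?m \<le> op_norm_mat (direct_sum_mat A B)" by simp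
qed

definition matrix_over_sum ::
  "'v mat set \<Rightarrow> ('v mat \<Rightarrow> complex mat) mat \<Rightarrow> ('v mat \<Rightarrow> complex mat) mat \<Rightarrow> ('v mat \<Rightarrow> complex mat) mat" where
  "matrix_over_sum \<Xi> P Q = mat (dim_row P + dim_row Q) (dim_col P + dim_col Q) (\<lambda>(i, j).
     if i < dim_row P \<and> j < dim_col P then P $$ (i, j)
     else if dim_row P \<le> i \<and> dim_col P \<le> j then Q $$ (i - dim_row P, j - dim_col P)
     else nc_zero \<Xi>)"

lemma matrix_over_sum:
  assumes "matrix_over A P" "matrix_over A Q" "nc_zero \<Xi> \<in> A"
  shows "matrix_over A (matrix_over_sum \<Xi> P Q)"
proof -
  have P: "P $$ (i, j) \<in> A" if "i < dim_row P" "j < dim_col P" for i j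
    using assms(1) that unfolding matrix_over_def by blast
  have Q: "Q $$ (i, j) \<in> A" if "i < dim_row Q" "j < dim_col Q" for i j
    using assms(2) that unfolding matrix_over_def by blast
  have "elements_mat (matrix_over_sum \<Xi> P Q) \<subseteq> A"
  proof
    fix a assume "a \<in> elements_mat (matrix_over_sum \<Xi> P Q)"
    then obtain i j where "i < dim_row P + dim_row Q" "j < dim_col P + dim_col Q"
      "a = matrix_over_sum \<Xi> P Q $$ (i, j)"
      by (auto dest!: elements_matD simp: matrix_over_sum_def)
    then show "a \<in> A" using P Q assms(3) by (auto simp: matrix_over_sum_def)
  qed
  then show ?thesis using assms(1,2) by (simp add: matrix_over_def matrix_over_sum_def)
qed

lemma eval_matrix_over_sum:
  assumes z: "z \<in> \<Xi>" "z \<in> nc_space"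
  shows "eval_matrix (matrix_over_sum \<Xi> P Q) z = direct_sum_mat (eval_matrix P z) (eval_matrix Q z)"
proof (rule eq_matI)
  define n where "n = dim_row z"
  have n: "n > 0" using z by (simp add: nc_space_def n_def)
  fix i j
  assume "i < dim_row (direct_sum_mat (eval_matrix P z) (eval_matrix Q z))"
    "j < dim_col (direct_sum_mat (eval_matrix P z) (eval_matrix Q z))"
  then have i: "i < (dim_row P + dim_row Q) * n" and j: "j < (dim_col P + dim_col Q) * n"
    by (simp_all add: direct_sum_mat_def eval_matrix_def n_def Let_def distrib_right)
  have lt: "a div n < b \<longleftrightarrow> a < b * n" for a b by (simp add: div_less_iff_less_mult n)
  have md: "(a - b * n) div n = a div n - b" "(a - b * n) mod n = a mod n" if "b * n \<le> a" for a b
  proof -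
    obtain c where c: "a = c + b * n" using \<open>b * n \<le> a\<close> by (metis add.commute le_Suc_ex)
    show "(a - b * n) div n = a div n - b" "(a - b * n) mod n = a mod n" using n by (simp_all add: c)
  qed
  have mi: "i mod n < n" "j mod n < n" using n by auto
  have li: "i - dim_row P * n < dim_row Q * n" if "\<not> i < dim_row P * n" using i that by (simp add: distrib_right)
  have lj: "j - dim_col P * n < dim_col Q * n" if "\<not> j < dim_col P * n" using j that by (simp add: distrib_right)
  have i': "i div n < dim_row P + dim_row Q" and j': "j div n < dim_col P + dim_col Q"
    using i j by (simp_all only: lt)
  have E: "eval_matrix R z $$ (k, l) = (R $$ (k div n, l div n)) z $$ (k mod n, l mod n)"
    if "k < dim_row R * n" "l < dim_col R * n" for R k l
    using that by (simp add: eval_matrix_def Let_def n_def)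
  have EQ: "eval_matrix Q z $$ (i - dim_row P * n, j - dim_col P * n)
      = (Q $$ (i div n - dim_row P, j div n - dim_col P)) z $$ (i mod n, j mod n)"
    if "\<not> i < dim_row P * n" "\<not> j < dim_col P * n"
    by (simp only: E[OF li[OF that(1)] lj[OF that(2)]] md[OF leI[OF that(1)]] md[OF leI[OF that(2)]])
  have L: "eval_matrix (matrix_over_sum \<Xi> P Q) z $$ (i, j)
      = (matrix_over_sum \<Xi> P Q $$ (i div n, j div n)) z $$ (i mod n, j mod n)"
    by (rule E) (use i j in \<open>simp_all add: matrix_over_sum_def\<close>)
  have S: "matrix_over_sum \<Xi> P Q $$ (i div n, j div n) =
      (if i < dim_row P * n \<and> j < dim_col P * n then P $$ (i div n, j div n)
       else if \<not> i < dim_row P * n \<and> \<not> j < dim_col P * n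
       then Q $$ (i div n - dim_row P, j div n - dim_col P) else nc_zero \<Xi>)"
    using i' j' unfolding matrix_over_sum_def lt[symmetric] by (simp add: not_less)
  have Z: "nc_zero \<Xi> z $$ (i mod n, j mod n) = 0"
    using mi z(1) by (simp add: nc_zero_def n_def)
  have dims: "dim_row (eval_matrix R z) = dim_row R * n" "dim_col (eval_matrix R z) = dim_col R * n" for R
    by (simp_all add: eval_matrix_def Let_def n_def)
  have R: "direct_sum_mat (eval_matrix P z) (eval_matrix Q z) $$ (i, j) =
      (if i < dim_row P * n then if j < dim_col P * n then eval_matrix P z $$ (i, j) else 0
       else if j < dim_col P * n then 0
       else eval_matrix Q z $$ (i - dim_row P * n, j - dim_col P * n))"
    using i j li lj unfolding direct_sum_mat_def
    by (subst index_mat_four_block(1)) (simp_all only: dims distrib_right index_zero_mat split: if_split, simp_all)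
  show "eval_matrix (matrix_over_sum \<Xi> P Q) z $$ (i, j)
      = direct_sum_mat (eval_matrix P z) (eval_matrix Q z) $$ (i, j)"
    unfolding L R S using E[of i P j] EQ Z by presburger
qed (simp_all add: direct_sum_mat_def eval_matrix_def Let_def matrix_over_sum_def distrib_right)

lemma istopology_basic_free_sets:
  assumes "nc_set \<Xi>" and "nc_algebra scale \<Xi> A"
  shows "istopology (arbitrary union_of (\<lambda>U. \<exists>Q. matrix_over A Q \<and> U = basic_free_set \<Xi> Q))"
proof (rule istopology_base)
  fix S T
  assume "\<exists>Q. matrix_over A Q \<and> S = basic_free_set \<Xi> Q" "\<exists>Q. matrix_over A Q \<and> T = basic_free_set \<Xi> Q"
  then obtain P Q where "matrix_over A P" "matrix_over A Q"
    and ST: "S = basic_free_set \<Xi> P" "T = basic_free_set \<Xi> Q" by blast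
  with assms(2) have "matrix_over A (matrix_over_sum \<Xi> P Q)"
    by (intro matrix_over_sum) (auto simp: nc_algebra_def)
  moreover have "S \<inter> T = basic_free_set \<Xi> (matrix_over_sum \<Xi> P Q)"
    using assms(1) unfolding ST basic_free_set_def nc_set_def
    by (auto simp: eval_matrix_over_sum op_norm_mat_direct_sum subset_iff)
  ultimately show "\<exists>Q. matrix_over A Q \<and> S \<inter> T = basic_free_set \<Xi> Q" by blast
qed

lemma openin_free_topology:
  assumes "nc_set \<Xi>" and "nc_algebra scale \<Xi> A"
  shows "openin (free_topology \<Xi> A) =
    arbitrary union_of (\<lambda>U. \<exists>Q. matrix_over A Q \<and> U = basic_free_set \<Xi> Q)"
  unfolding free_topology_def
  by (rule topology_inverse'[OF istopology_basic_free_sets[OF assms]])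

end

theory Submission
  imports Defs "Jordan_Normal_Form.Determinant"
begin

text \<open>
  Boundedness forces invariance. Let \<open>z \<in> \<D>\<^sub>Q\<close>, let \<open>v\<close> be a vector, and let \<open>P\<close> be the orthogonal projection onto
  \<open>M = {p(z) v : p \<in> A}\<close>, which every \<open>p(z)\<close> leaves invariant. Conjugating \<open>z\<close> by \<open>1 + (t - 1) P\<close> with
  \<open>t \<ge> 1\<close> scales the off-diagonal corner of each \<open>p(z)\<close> by \<open>1/t\<close>, so by convexity it does not
  increase the norm of \<open>Q\<close> and stays in \<open>\<D>\<^sub>Q\<close>; but it scales the opposite corner of \<open>f(z)\<close> by \<open>t\<close>,
  which must therefore vanish. Hence \<open>f(z) v \<in> M\<close>, and applying this to a direct sum of copies of \<open>\<lambda>\<close> and the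
  vector formed from a basis gives \<open>f(\<lambda>) = p(\<lambda>)\<close> for some \<open>p \<in> A\<close>. For \<open>x \<in> V\<^sub>\<lambda>\<close> one interpolates at
  \<open>\<lambda> \<oplus> x\<close>.

  An nc set that is compact in the free topology lies in a single member of each cover of it by basic sets, since the
  direct sum of points omitted by finitely many members is omitted by all of them. Points outside
  \<open>V\<^sub>\<lambda>\<close> can be separated from \<open>\<lambda>\<close> by basic sets, so a compact nc set lies in one of its \<open>V\<^sub>\<lambda>\<close>.
  Conversely, the nc set generated by two points is compact, because \<open>\<D>\<^sub>P\<close> contains it as soon as it contains
  their direct sum.
\<close>

section \<open>Orthogonal projections\<close>

text \<open>If k > n, the first n vectors are the rows of a square matrix with orthonormal rows.
  Such a matrix is injective, yet it annihilates the conjugate of the next vector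
  \<open>u n\<close>, which would then be zero although it has norm one.\<close>

lemma orthonormal_card_le:
  fixes u :: "nat \<Rightarrow> complex vec"
  assumes u: "\<And>i. i < k \<Longrightarrow> u i \<in> carrier_vec n"
    and on: "\<And>i j. i < k \<Longrightarrow> j < k \<Longrightarrow> u i \<bullet>c u j = (if i = j then 1 else 0)"
  shows "k \<le> n"
proof (rule ccontr)
  assume "\<not> k \<le> n"
  then have nk: "n < k" by simp
  define U where "U = mat n n (\<lambda>(i, a). u i $ a)"
  define V where "V = mat n n (\<lambda>(a, i). cnj (u i $ a))"
  have UV: "U \<in> carrier_mat n n" "V \<in> carrier_mat n n" by (simp_all add: U_def V_def)
  have sp: "u i \<bullet>c u j = (\<Sum>a<n. u i $ a * cnj (u j $ a))" if "i < k" "j < k" for i j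
    using u[OF that(1)] u[OF that(2)]
    by (auto simp: scalar_prod_def conjugate_complex_def atLeast0LessThan intro!: sum.cong)
  have "U * V = 1\<^sub>m n"
  proof (rule eq_matI)
    fix i j assume "i < dim_row (1\<^sub>m n :: complex mat)" "j < dim_col (1\<^sub>m n :: complex mat)"
    then show "(U * V) $$ (i, j) = 1\<^sub>m n $$ (i, j)"
      using sp[of i j] on[of i j] nk
      by (simp add: U_def V_def scalar_prod_def atLeast0LessThan)
  qed (simp_all add: U_def V_def)
  \<comment> \<open>A one-sided inverse of a square matrix is two-sided; this turns orthonormality
    of the rows into injectivity of \<open>U\<close>.\<close>
  then have VU: "V * U = 1\<^sub>m n" by (rule mat_mult_left_right_inverse[OF UV])
  define x where "x = conjugate (u n)"
  have x: "x \<in> carrier_vec n" using u[OF nk] by (auto simp: x_def)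
  have "U *\<^sub>v x = 0\<^sub>v n"
  proof (rule eq_vecI)
    fix i assume "i < dim_vec (0\<^sub>v n :: complex vec)"
    then show "(U *\<^sub>v x) $ i = 0\<^sub>v n $ i"
      using sp[of i n] on[of i n] nk u[OF nk]
      by (auto simp: U_def x_def scalar_prod_def atLeast0LessThan conjugate_complex_def)
  qed (simp add: U_def)
  then have "x = V *\<^sub>v 0\<^sub>v n"
    using assoc_mult_mat_vec[OF UV(2,1) x] x by (simp add: VU)
  moreover have "V *\<^sub>v 0\<^sub>v n = 0\<^sub>v n" using UV by (intro eq_vecI) auto
  ultimately have "x = 0\<^sub>v n" by simp
  then have "u n \<bullet>c u n = 0" using u[OF nk] by (simp add: x_def[symmetric])
  then show False using on[OF nk nk] by simp
qed

text \<open>Orthonormal systems in \<open>M\<close> have length at most n, so there is one of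
  maximal length. The sum of the rank-one projections onto its members maps into \<open>M\<close>,
  and maximality makes it fix all of \<open>M\<close>.\<close>

lemma orthogonal_projection_exists:
  fixes M :: "complex vec set"
  assumes M: "M \<subseteq> carrier_vec n" and zero: "0\<^sub>v n \<in> M"
    and add: "\<And>v w. v \<in> M \<Longrightarrow> w \<in> M \<Longrightarrow> v + w \<in> M"
    and smult: "\<And>c v. v \<in> M \<Longrightarrow> c \<cdot>\<^sub>v v \<in> M"
  obtains P where "P \<in> carrier_mat n n"
    and "\<And>a b. a < n \<Longrightarrow> b < n \<Longrightarrow> P $$ (b, a) = cnj (P $$ (a, b))"
    and "\<And>v. v \<in> M \<Longrightarrow> P *\<^sub>v v = v" and "\<And>v. v \<in> carrier_vec n \<Longrightarrow> P *\<^sub>v v \<in> M"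
proof -
  define ON where "ON k u \<longleftrightarrow> (\<forall>i<k. u i \<in> M) \<and>
    (\<forall>i<k. \<forall>j<k. u i \<bullet>c u j = (if i = j then 1 else 0))" for k and u :: "nat \<Rightarrow> complex vec"
  have ON_le: "k \<le> n" if "ON k u" for k u
    by (rule orthonormal_card_le[of k u]) (use that M in \<open>auto simp: ON_def\<close>)
  have "\<exists>u. ON 0 u" by (simp add: ON_def)
  then obtain k where "\<exists>u. ON k u" and "\<forall>j. (\<exists>u. ON j u) \<longrightarrow> j \<le> k"
    using Nat.ex_has_greatest_nat[of "\<lambda>k. \<exists>u. ON k u" 0 "n"] ON_le by auto
  then obtain u where u: "ON k u" and k_max: "\<And>v. \<not> ON (Suc k) v"
    by (metis Suc_n_not_le_n)
  have uM: "u i \<in> M" and uc: "u i \<in> carrier_vec n" if "i < k" for i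
    using u that M by (auto simp: ON_def)
  define P where "P = mat n n (\<lambda>(a, b). \<Sum>i<k. u i $ a * cnj (u i $ b))"
  have P: "P \<in> carrier_mat n n" by (simp add: P_def)
  have ip: "v \<bullet>c w = (\<Sum>a<n. v $ a * cnj (w $ a))" if "v \<in> carrier_vec n" "w \<in> carrier_vec n" for v w
    using that by (auto simp: scalar_prod_def conjugate_complex_def atLeast0LessThan intro!: sum.cong)
  have comb: "vec n (\<lambda>a. \<Sum>i<j. c i * u i $ a) \<in> M" if "j \<le> k" for j c
    using that
  proof (induction j)
    case 0
    have "vec n (\<lambda>a. 0) = (0\<^sub>v n :: complex vec)" by (rule eq_vecI) auto
    then show ?case using zero by simp
  next
    case (Suc j)
    have "vec n (\<lambda>a. \<Sum>i<Suc j. c i * u i $ a) = vec n (\<lambda>a. \<Sum>i<j. c i * u i $ a) + c j \<cdot>\<^sub>v u j"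
      using uc[of j] Suc.prems by (intro eq_vecI) auto
    then show ?case using Suc add smult uM[of j] by simp
  qed
  have Pv: "P *\<^sub>v v = vec n (\<lambda>a. \<Sum>i<k. (v \<bullet>c u i) * u i $ a)" if v: "v \<in> carrier_vec n" for v
  proof (rule eq_vecI)
    fix a assume "a < dim_vec (vec n (\<lambda>a. \<Sum>i<k. (v \<bullet>c u i) * u i $ a))"
    then have a: "a < n" by simp
    have "(P *\<^sub>v v) $ a = (\<Sum>b<n. \<Sum>i<k. u i $ a * cnj (u i $ b) * v $ b)"
      using a v by (simp add: P_def scalar_prod_def atLeast0LessThan sum_distrib_right)
    also have "\<dots> = (\<Sum>i<k. \<Sum>b<n. u i $ a * cnj (u i $ b) * v $ b)" by (rule sum.swap)
    also have "\<dots> = (\<Sum>i<k. (v \<bullet>c u i) * u i $ a)"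
      by (rule sum.cong) (simp_all add: ip[OF v uc] sum_distrib_left sum_distrib_right mult_ac)
    finally show "(P *\<^sub>v v) $ a = vec n (\<lambda>a. \<Sum>i<k. (v \<bullet>c u i) * u i $ a) $ a" using a by simp
  qed (simp add: P_def)
  have range: "P *\<^sub>v v \<in> M" if "v \<in> carrier_vec n" for v
    using comb[of k "\<lambda>i. v \<bullet>c u i"] by (simp add: Pv[OF that])
  \<comment> \<open>If some m in \<open>M\<close> were moved, its residual \<open>r\<close> would be
    a nonzero element of \<open>M\<close> orthogonal to the system, and its normalization
    \<open>w\<close> would extend the system.\<close>
  have fixed: "P *\<^sub>v m = m" if m: "m \<in> M" for m
  proof (rule ccontr)
    assume ne: "P *\<^sub>v m \<noteq> m"
    have mc: "m \<in> carrier_vec n" using m M by auto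
    define r where "r = m + (-1) \<cdot>\<^sub>v (P *\<^sub>v m)"
    have rM: "r \<in> M" unfolding r_def by (intro add m smult range mc)
    then have rc: "r \<in> carrier_vec n" using M by auto
    have r0: "r \<noteq> 0\<^sub>v n"
    proof
      assume *: "r = 0\<^sub>v n"
      have "P *\<^sub>v m = m"
      proof (rule eq_vecI)
        fix a assume "a < dim_vec m"
        then have a: "a < n" using mc by auto
        then have "r $ a = m $ a - (P *\<^sub>v m) $ a" using mc P by (simp add: r_def)
        then show "(P *\<^sub>v m) $ a = m $ a" using * a by simp
      qed (use mc P in auto)
      with ne show False ..
    qed
    have orth: "r \<bullet>c u j = 0" if j: "j < k" for j
    proof -
      have "(P *\<^sub>v m) \<bullet>c u j = (\<Sum>a<n. \<Sum>i<k. (m \<bullet>c u i) * u i $ a * cnj (u j $ a))"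
        using uc[OF j] P by (subst ip) (auto simp: Pv[OF mc] sum_distrib_right)
      also have "\<dots> = (\<Sum>i<k. (m \<bullet>c u i) * (u i \<bullet>c u j))"
        by (subst sum.swap, rule sum.cong) (simp_all add: ip[OF uc uc] j sum_distrib_left mult_ac)
      also have "\<dots> = (\<Sum>i<k. if i = j then m \<bullet>c u i else 0)"
        using u j by (intro sum.cong) (auto simp: ON_def)
      finally have "(P *\<^sub>v m) \<bullet>c u j = m \<bullet>c u j" using j by simp
      moreover have "r \<bullet>c u j = m \<bullet>c u j - (P *\<^sub>v m) \<bullet>c u j"
        using mc P uc[OF j] by (subst (1 2 3) ip) (auto simp: r_def sum_subtractf[symmetric] algebra_simps)
      ultimately show ?thesis by simp
    qed
    have orth': "u j \<bullet>c r = 0" if j: "j < k" for j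
    proof -
      have "u j \<bullet>c r = cnj (r \<bullet>c u j)"
        by (simp add: ip[OF uc[OF j] rc] ip[OF rc uc[OF j]] mult_ac)
      then show ?thesis by (simp add: orth[OF j])
    qed
    define \<rho> where "\<rho> = l2_norm_vec r"
    have rr: "r \<bullet>c r = of_real (\<rho>\<^sup>2)"
      using rc by (simp add: ip[OF rc rc] \<rho>_def l2_norm_vec_sq complex_norm_square[symmetric])
    have "r \<bullet>c r \<noteq> 0" using r0 conjugate_square_eq_0_vec[OF rc] by simp
    then have \<rho>0: "\<rho> \<noteq> 0" using rr by auto
    define c where "c = complex_of_real (1 / \<rho>)"
    have c: "cnj c = c" by (simp add: c_def)
    define w where "w = c \<cdot>\<^sub>v r"
    have wc: "w \<in> carrier_vec n" and wM: "w \<in> M" using rc rM smult by (auto simp: w_def)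
    have w1: "w \<bullet>c u j = 0" "u j \<bullet>c w = 0" if "j < k" for j
    proof -
      have "w \<bullet>c u j = c * (r \<bullet>c u j)"
        using rc unfolding ip[OF wc uc[OF that]] ip[OF rc uc[OF that]]
        by (simp add: w_def sum_distrib_left mult_ac)
      then show "w \<bullet>c u j = 0" using orth[OF that] by simp
      have "u j \<bullet>c w = c * (u j \<bullet>c r)"
        using rc unfolding ip[OF uc[OF that] wc] ip[OF uc[OF that] rc]
        by (simp add: w_def c sum_distrib_left mult_ac)
      then show "u j \<bullet>c w = 0" using orth'[OF that] by simp
    qed
    have "w \<bullet>c w = c * c * (r \<bullet>c r)"
      using rc unfolding ip[OF wc wc] ip[OF rc rc] by (simp add: w_def c sum_distrib_left mult_ac)
    then have w2: "w \<bullet>c w = 1" using \<rho>0 by (simp add: rr c_def power2_eq_square)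
    have "ON (Suc k) (u(k := w))"
      using u wM w1 w2 unfolding ON_def less_Suc_eq by (auto split: if_splits)
    then show False using k_max by blast
  qed
  show thesis
    by (rule that[OF P _ fixed range]) (simp_all add: P_def mult_ac)
qed

text \<open>Such a matrix is its own adjoint and its own inverse, hence unitary. It is applied to
  the reflection 1 - 2P.\<close>

lemma hermitian_involution_isometry:
  fixes x :: "nat \<Rightarrow> complex"
  assumes W: "W \<in> carrier_mat n n" and WW: "W * W = 1\<^sub>m n"
    and herm: "\<And>a b. a < n \<Longrightarrow> b < n \<Longrightarrow> W $$ (b, a) = cnj (W $$ (a, b))"
  shows "(\<Sum>a<n. (cmod (\<Sum>b<n. W $$ (a, b) * x b))\<^sup>2) = (\<Sum>b<n. (cmod (x b))\<^sup>2)"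
proof -
  have \<delta>: "(\<Sum>a<n. W $$ (c, a) * W $$ (a, b)) = (if c = b then 1 else 0)" if "b < n" "c < n" for b c
  proof -
    have "(W * W) $$ (c, b) = (\<Sum>a<n. W $$ (c, a) * W $$ (a, b))"
      using W that by (simp add: scalar_prod_def atLeast0LessThan)
    then show ?thesis using that by (simp add: WW)
  qed
  have "of_real (\<Sum>a<n. (cmod (\<Sum>b<n. W $$ (a, b) * x b))\<^sup>2)
      = (\<Sum>a<n. (\<Sum>b<n. W $$ (a, b) * x b) * (\<Sum>c<n. W $$ (c, a) * cnj (x c)))"
    unfolding of_real_sum complex_norm_square cnj_sum complex_cnj_mult
    by (intro sum.cong refl arg_cong2[where f = "(*)"]) (simp add: herm[symmetric])
  also have "\<dots> = (\<Sum>a<n. \<Sum>b<n. \<Sum>c<n. (W $$ (c, a) * W $$ (a, b)) * (x b * cnj (x c)))"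
    by (simp add: sum_product mult_ac)
  also have "\<dots> = (\<Sum>b<n. \<Sum>a<n. \<Sum>c<n. (W $$ (c, a) * W $$ (a, b)) * (x b * cnj (x c)))"
    by (rule sum.swap)
  also have "\<dots> = (\<Sum>b<n. \<Sum>c<n. \<Sum>a<n. (W $$ (c, a) * W $$ (a, b)) * (x b * cnj (x c)))"
    by (intro sum.cong refl sum.swap)
  also have "\<dots> = (\<Sum>b<n. \<Sum>c<n. (if c = b then 1 else 0) * (x b * cnj (x c)))"
    by (intro sum.cong refl) (simp add: sum_distrib_right[symmetric] \<delta>)
  also have "\<dots> = (\<Sum>b<n. x b * cnj (x b))"
    by (intro sum.cong refl) (simp add: if_distrib[of "\<lambda>t. t * _"] cong: if_cong)
  also have "\<dots> = of_real (\<Sum>b<n. (cmod (x b))\<^sup>2)" by (simp only: of_real_sum complex_norm_square)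
  finally show ?thesis by (simp only: of_real_eq_iff)
qed

section \<open>Direct sums and similarities\<close>

lemma left_act_mult:
  assumes "vector_space scale" and \<alpha>: "\<alpha> \<in> carrier_mat m n" and \<beta>: "\<beta> \<in> carrier_mat n k" and x: "x \<in> carrier_mat k l"
  shows "left_act scale (\<alpha> * \<beta>) x = left_act scale \<alpha> (left_act scale \<beta> x)"
proof (rule eq_matI)
  interpret vector_space scale by fact
  fix i j
  assume "i < dim_row (left_act scale \<alpha> (left_act scale \<beta> x))" "j < dim_col (left_act scale \<alpha> (left_act scale \<beta> x))"
  then have i: "i < m" and j: "j < l" using \<alpha> x by (auto simp: left_act_def)
  have "left_act scale (\<alpha> * \<beta>) x $$ (i, j)
      = (\<Sum>h<k. scale (\<Sum>g<n. \<alpha> $$ (i, g) * \<beta> $$ (g, h)) (x $$ (h, j)))"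
    using i j \<alpha> \<beta> x by (simp add: left_act_def scalar_prod_def atLeast0LessThan)
  also have "\<dots> = (\<Sum>g<n. \<Sum>h<k. scale (\<alpha> $$ (i, g)) (scale (\<beta> $$ (g, h)) (x $$ (h, j))))"
    by (simp add: scale_sum_left sum.swap[of _ "{..<n}"])
  also have "\<dots> = left_act scale \<alpha> (left_act scale \<beta> x) $$ (i, j)"
    using i j \<alpha> \<beta> x by (simp add: left_act_def scale_sum_right)
  finally show "left_act scale (\<alpha> * \<beta>) x $$ (i, j) = left_act scale \<alpha> (left_act scale \<beta> x) $$ (i, j)" .
qed (use \<alpha> \<beta> x in \<open>auto simp: left_act_def\<close>)

text \<open>The inclusion of C^n into C^N as the coordinates from d on. Intertwiners of this kind
  link the value of an nc function at a summand with its value at the direct sum.\<close>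

definition coord_embed :: "nat \<Rightarrow> nat \<Rightarrow> nat \<Rightarrow> complex mat" where
  "coord_embed N n d = mat N n (\<lambda>(i, j). if i = d + j then 1 else 0)"

lemma left_act_coord_embed:
  assumes "vector_space scale" and x: "x \<in> carrier_mat n l" and i: "i < N" and j: "j < l"
  shows "left_act scale (coord_embed N n d) x $$ (i, j)
    = (if d \<le> i \<and> i < d + n then x $$ (i - d, j) else 0)"
proof -
  interpret vector_space scale by fact
  have "left_act scale (coord_embed N n d) x $$ (i, j)
      = (\<Sum>k<n. if k = i - d \<and> d \<le> i then x $$ (k, j) else 0)"
    using x i j by (auto simp: left_act_def coord_embed_def intro!: sum.cong)
  also have "\<dots> = (if d \<le> i \<and> i < d + n then x $$ (i - d, j) else 0)"
    by (cases "d \<le> i") auto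
  finally show ?thesis .
qed

lemma right_act_coord_embed:
  assumes "vector_space scale" and z: "z \<in> carrier_mat m N" and i: "i < m" and j: "j < n" and "d + n \<le> N"
  shows "right_act scale z (coord_embed N n d) $$ (i, j) = z $$ (i, d + j)"
proof -
  interpret vector_space scale by fact
  have "right_act scale z (coord_embed N n d) $$ (i, j) = (\<Sum>k<N. if k = d + j then z $$ (i, k) else 0)"
    using z i j assms(5) by (simp add: right_act_def coord_embed_def if_distrib[of "\<lambda>t. scale t _"] cong: if_cong)
  then show ?thesis using assms by simp
qed

lemma nc_function_carrier:
  assumes "nc_function scale \<Omega> f" "x \<in> \<Omega>" "x \<in> nc_space"
  shows "f x \<in> carrier_mat (dim_row x) (dim_row x)"
  using assms by (auto simp: nc_function_def graded_on_def nc_level_def nc_space_def)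

lemma nc_functionD:
  assumes "nc_function scale \<Omega> f" "x \<in> \<Omega>" "y \<in> \<Omega>" "x \<in> carrier_mat n n" "y \<in> carrier_mat m m"
    "\<alpha> \<in> carrier_mat m n" "left_act scale \<alpha> x = right_act scale y \<alpha>"
  shows "\<alpha> * f x = f y * \<alpha>"
  using assms by (auto simp: nc_function_def nc_level_def)

text \<open>Each summand is intertwined with the direct sum by its coordinate inclusion, and the
  resulting identity for f determines the block of columns of \<open>f ?z\<close> that belongs to
  this summand.\<close>

lemma nc_function_direct_sum:
  assumes vs: "vector_space scale" and f: "nc_function scale \<Omega> f" and \<Omega>: "nc_set \<Omega>"
    and x: "x \<in> \<Omega>" and y: "y \<in> \<Omega>"
  shows "f (direct_sum_mat x y) = direct_sum_mat (f x) (f y)"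
proof -
  define n m where "n = dim_row x" and "m = dim_row y"
  let ?z = "direct_sum_mat x y"
  have z: "?z \<in> \<Omega>" using \<Omega> x y by (auto simp: nc_set_def)
  have sp: "x \<in> nc_space" "y \<in> nc_space" "?z \<in> nc_space" using \<Omega> x y z by (auto simp: nc_set_def)
  have xc: "x \<in> carrier_mat n n" and yc: "y \<in> carrier_mat m m" and zc: "?z \<in> carrier_mat (n + m) (n + m)"
    using sp by (auto simp: nc_space_def n_def m_def direct_sum_mat_def)
  have fc: "f x \<in> carrier_mat n n" "f y \<in> carrier_mat m m" "f ?z \<in> carrier_mat (n + m) (n + m)"
    using nc_function_carrier[OF f x sp(1)] nc_function_carrier[OF f y sp(2)] nc_function_carrier[OF f z sp(3)]
      carrier_matD(1)[OF zc] by (simp_all add: n_def m_def)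
  \<comment> \<open>With C as a vector space over itself, the rules for \<open>left_act\<close> and
    \<open>right_act\<close> also compute the ordinary products with
    \<open>coord_embed\<close>.\<close>
  have vc: "vector_space ((*) :: complex \<Rightarrow> complex \<Rightarrow> complex)"
    by unfold_locales (simp_all add: algebra_simps)
  \<comment> \<open>Both summands at once: offset 0 and size n for x, offset n and size m for
    y.\<close>
  have cols: "f ?z $$ (i, d + j) = (if d \<le> i \<and> i < d + k then f w $$ (i - d, j) else 0)"
    if w: "w \<in> \<Omega>" "w \<in> carrier_mat k k" "f w \<in> carrier_mat k k" and dk: "d + k \<le> n + m"
      and it: "\<And>i j. i < n + m \<Longrightarrow> j < k \<Longrightarrow>
        ?z $$ (i, d + j) = (if d \<le> i \<and> i < d + k then w $$ (i - d, j) else 0)"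
      and i: "i < n + m" and j: "j < k" for w d k i j
  proof -
    let ?J = "coord_embed (n + m) k d"
    have J: "?J \<in> carrier_mat (n + m) k" by (simp add: coord_embed_def)
    have "left_act scale ?J w = right_act scale ?z ?J"
    proof (rule eq_matI)
      fix i j assume "i < dim_row (right_act scale ?z ?J)" "j < dim_col (right_act scale ?z ?J)"
      then have "i < n + m" "j < k" using zc J by (auto simp: right_act_def)
      then show "left_act scale ?J w $$ (i, j) = right_act scale ?z ?J $$ (i, j)"
        by (simp add: left_act_coord_embed[OF vs w(2)] right_act_coord_embed[OF vs zc _ _ dk] it)
    qed (use w zc J in \<open>auto simp: left_act_def right_act_def\<close>)
    then have eq: "?J * f w = f ?z * ?J" by (rule nc_functionD[OF f w(1) z w(2) zc J])
    have "f ?z $$ (i, d + j) = right_act (*) (f ?z) ?J $$ (i, j)"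
      using right_act_coord_embed[OF vc fc(3) i j dk] by simp
    also have "\<dots> = (f ?z * ?J) $$ (i, j)"
      using i j fc(3) J by (auto simp: right_act_def scalar_prod_def atLeast0LessThan mult_ac intro!: sum.cong)
    also have "\<dots> = left_act (*) ?J (f w) $$ (i, j)"
      unfolding eq[symmetric] using i j w(3) J by (auto simp: left_act_def scalar_prod_def atLeast0LessThan intro!: sum.cong)
    finally show ?thesis using left_act_coord_embed[OF vc w(3) i j] by simp
  qed
  show ?thesis
  proof (rule eq_matI)
    fix i j assume "i < dim_row (direct_sum_mat (f x) (f y))" "j < dim_col (direct_sum_mat (f x) (f y))"
    then have i: "i < n + m" and j: "j < n + m" using fc by (auto simp: direct_sum_mat_def)
    show "f ?z $$ (i, j) = direct_sum_mat (f x) (f y) $$ (i, j)"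
    proof (cases "j < n")
      case True
      have "f ?z $$ (i, 0 + j) = (if 0 \<le> i \<and> i < 0 + n then f x $$ (i - 0, j) else 0)"
        by (rule cols[OF x xc fc(1) _ _ i True]) (use xc yc in \<open>auto simp: direct_sum_mat_def\<close>)
      then show ?thesis using i j True fc by (auto simp: direct_sum_mat_def)
    next
      case False
      then have jn: "j - n < m" using j by simp
      have "f ?z $$ (i, n + (j - n)) = (if n \<le> i \<and> i < n + m then f y $$ (i - n, j - n) else 0)"
        by (rule cols[OF y yc fc(2) _ _ i jn]) (use xc yc in \<open>auto simp: direct_sum_mat_def\<close>)
      then show ?thesis using i j False fc by (auto simp: direct_sum_mat_def)
    qed
  qed (use fc in \<open>auto simp: direct_sum_mat_def\<close>)
qed

text \<open>The point is z conjugated by \<open>S\<close>, with \<open>T\<close> the inverse of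
  \<open>S\<close>. Fullness, as opposed to closure under direct sums, enters only here, for the
  injective matrix \<open>S\<close>.\<close>

lemma full_nc_set_similar:
  assumes vs: "vector_space scale" and \<Xi>: "full_nc_set scale \<Xi>" and z: "z \<in> \<Xi>" "z \<in> carrier_mat n n"
    and S: "S \<in> carrier_mat n n" and T: "T \<in> carrier_mat n n" and ST: "S * T = 1\<^sub>m n" and TS: "T * S = 1\<^sub>m n"
  obtains y where "y \<in> \<Xi>" "y \<in> carrier_mat n n" "left_act scale S y = right_act scale z S"
proof
  interpret vector_space scale by fact
  define w where "w = right_act scale z S"
  have w: "w \<in> carrier_mat n n" using z S by (auto simp: w_def right_act_def)
  let ?y = "left_act scale T w"
  show y: "?y \<in> carrier_mat n n" using w T by (auto simp: left_act_def)
  have "left_act scale (1\<^sub>m n) w = w"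
  proof (rule eq_matI)
    fix i j assume "i < dim_row w" "j < dim_col w"
    then have ij: "i < n" "j < n" using w by auto
    have "left_act scale (1\<^sub>m n) w $$ (i, j) = (\<Sum>k<n. if k = i then w $$ (k, j) else 0)"
      using w ij by (simp add: left_act_def if_distrib[of "\<lambda>t. scale t _"] cong: if_cong)
    then show "left_act scale (1\<^sub>m n) w $$ (i, j) = w $$ (i, j)" using ij by simp
  qed (use w in \<open>auto simp: left_act_def\<close>)
  then have eq: "left_act scale S ?y = w" using left_act_mult[OF vs S T w] ST by simp
  then show "left_act scale S ?y = right_act scale z S" by (simp add: w_def)
  have "inj_on ((*\<^sub>v) S) (carrier_vec n)"
  proof (rule inj_on_inverseI[where g = "(*\<^sub>v) T"])
    fix v :: "complex vec" assume "v \<in> carrier_vec n"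
    then show "T *\<^sub>v (S *\<^sub>v v) = v" using assoc_mult_mat_vec[OF T S, of v] TS by simp
  qed
  moreover have "z \<in> nc_level \<Xi> n" using z by (simp add: nc_level_def)
  moreover have "0 < n" using \<Xi> z by (auto simp: full_nc_set_def nc_set_def nc_space_def)
  then have "?y \<in> nc_level nc_space n" using y by (auto simp: nc_level_def nc_space_def)
  ultimately have "?y \<in> nc_level \<Xi> n"
    using \<Xi> S eq unfolding full_nc_set_def w_def by blast
  then show "?y \<in> \<Xi>" by (simp add: nc_level_def)
qed

lemma nc_function_similar:
  assumes f: "nc_function scale \<Omega> f" and y: "y \<in> \<Omega>" "y \<in> carrier_mat n n" and z: "z \<in> \<Omega>" "z \<in> carrier_mat n n"
    and S: "S \<in> carrier_mat n n" and T: "T \<in> carrier_mat n n" and TS: "T * S = 1\<^sub>m n"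
    and eq: "left_act scale S y = right_act scale z S"
  shows "f y = T * (f z * S)"
proof -
  have fy: "f y \<in> carrier_mat n n"
    using f y by (auto simp: nc_function_def graded_on_def nc_level_def)
  have "S * f y = f z * S" by (rule nc_functionD[OF f y(1) z(1) y(2) z(2) S eq])
  then have "T * (f z * S) = T * (S * f y)" by simp
  also have "\<dots> = f y" using assoc_mult_mat[OF T S fy] TS fy by simp
  finally show ?thesis ..
qed

section \<open>Norms of block matrices\<close>

lemma sum_lessThan_add: "(\<Sum>i<m + k. g i) = (\<Sum>i<m. g i) + (\<Sum>i<k. g (m + i :: nat) :: 'a::comm_monoid_add)"
  by (induction k) (simp_all add: add.assoc)

lemma sum_lessThan_mult: "(\<Sum>k<s * n. g k) = (\<Sum>i<s. \<Sum>a<n. g (i * n + a :: nat) :: 'a::comm_monoid_add)"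
proof (induction s)
  case (Suc s)
  have "(\<Sum>k<Suc s * n. g k) = (\<Sum>k<s * n + n. g k)" by (simp add: add.commute)
  then show ?case using Suc by (simp only: sum_lessThan_add sum.lessThan_Suc)
qed simp

text \<open>
  The bound \<open>c\<close> on the operator norm of a block matrix with \<open>n \<times> n\<close> blocks \<open>F i j\<close>, in coordinates that
  do not involve \<open>div\<close> and \<open>mod\<close>; the entries of \<open>V\<close> outside \<open>r \<times> n\<close> are irrelevant.
\<close>

definition block_norm_le :: "(nat \<Rightarrow> nat \<Rightarrow> complex mat) \<Rightarrow> nat \<Rightarrow> nat \<Rightarrow> nat \<Rightarrow> real \<Rightarrow> bool" where
  "block_norm_le F s r n c \<longleftrightarrow> (\<forall>V :: nat \<Rightarrow> nat \<Rightarrow> complex.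
     (\<Sum>i<s. \<Sum>a<n. (cmod (\<Sum>j<r. \<Sum>b<n. F i j $$ (a, b) * V j b))\<^sup>2)
       \<le> c\<^sup>2 * (\<Sum>j<r. \<Sum>b<n. (cmod (V j b))\<^sup>2))"

lemma op_norm_mat_le_iff:
  assumes "0 \<le> c"
  shows "op_norm_mat B \<le> c \<longleftrightarrow>
    (\<forall>v\<in>carrier_vec (dim_col B). (l2_norm_vec (B *\<^sub>v v))\<^sup>2 \<le> c\<^sup>2 * (l2_norm_vec v)\<^sup>2)"
proof
  assume le: "op_norm_mat B \<le> c"
  show "\<forall>v\<in>carrier_vec (dim_col B). (l2_norm_vec (B *\<^sub>v v))\<^sup>2 \<le> c\<^sup>2 * (l2_norm_vec v)\<^sup>2"
  proof
    fix v :: "complex vec" assume "v \<in> carrier_vec (dim_col B)"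
    then have "l2_norm_vec (B *\<^sub>v v) \<le> op_norm_mat B * l2_norm_vec v" by (rule op_norm_mat_bound)
    also have "\<dots> \<le> c * l2_norm_vec v" using le by (intro mult_right_mono l2_norm_vec_nonneg)
    finally have "(l2_norm_vec (B *\<^sub>v v))\<^sup>2 \<le> (c * l2_norm_vec v)\<^sup>2"
      by (intro power_mono l2_norm_vec_nonneg)
    then show "(l2_norm_vec (B *\<^sub>v v))\<^sup>2 \<le> c\<^sup>2 * (l2_norm_vec v)\<^sup>2" by (simp add: power_mult_distrib)
  qed
next
  assume *: "\<forall>v\<in>carrier_vec (dim_col B). (l2_norm_vec (B *\<^sub>v v))\<^sup>2 \<le> c\<^sup>2 * (l2_norm_vec v)\<^sup>2"
  show "op_norm_mat B \<le> c"
  proof (rule op_norm_mat_le)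
    fix v assume v: "v \<in> carrier_vec (dim_col B)" "l2_norm_vec v \<le> 1"
    then have "(l2_norm_vec (B *\<^sub>v v))\<^sup>2 \<le> (c * l2_norm_vec v)\<^sup>2" using * by (simp add: power_mult_distrib)
    then have "l2_norm_vec (B *\<^sub>v v) \<le> c * l2_norm_vec v"
      by (rule power2_le_imp_le) (simp add: assms l2_norm_vec_nonneg)
    also have "\<dots> \<le> c" by (rule mult_left_le[OF v(2) assms])
    finally show "l2_norm_vec (B *\<^sub>v v) \<le> c" .
  qed
qed

text \<open>Position i * n + a of a long vector is the pair (i, a). Once the sums are split this
  way, both sides are the same inequality between sums of squares.\<close>

lemma op_norm_eval_matrix_le_iff:
  assumes c: "0 \<le> c" and n: "dim_row z = n" "0 < n"
  shows "op_norm_mat (eval_matrix Q z) \<le> c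
    \<longleftrightarrow> block_norm_le (\<lambda>i j. (Q $$ (i, j)) z) (dim_row Q) (dim_col Q) n c"
proof -
  define s r E where "s = dim_row Q" and "r = dim_col Q" and "E = eval_matrix Q z"
  have Ec: "E \<in> carrier_mat (s * n) (r * n)"
    by (simp add: E_def eval_matrix_def n s_def r_def Let_def)
  have lt: "i * n + a < k * n" if "i < k" "a < n" for i a k
  proof -
    have "i * n + a < Suc i * n" using that by simp
    also have "\<dots> \<le> k * n" using that by (intro mult_right_mono) auto
    finally show ?thesis .
  qed
  have entry: "E $$ (i * n + a, j * n + b) = (Q $$ (i, j)) z $$ (a, b)"
    if "i < s" "j < r" "a < n" "b < n" for i j a b
    using that lt n by (simp add: E_def eval_matrix_def s_def r_def Let_def)
  have norm: "(l2_norm_vec (E *\<^sub>v v))\<^sup>2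
      = (\<Sum>i<s. \<Sum>a<n. (cmod (\<Sum>j<r. \<Sum>b<n. (Q $$ (i, j)) z $$ (a, b) * v $ (j * n + b)))\<^sup>2)"
    if v: "v \<in> carrier_vec (r * n)" for v
  proof -
    have "(l2_norm_vec (E *\<^sub>v v))\<^sup>2 = (\<Sum>k<s * n. (cmod (\<Sum>l<r * n. E $$ (k, l) * v $ l))\<^sup>2)"
      using Ec v by (auto simp: l2_norm_vec_sq scalar_prod_def atLeast0LessThan intro!: sum.cong)
    also have "\<dots> = (\<Sum>i<s. \<Sum>a<n. (cmod (\<Sum>j<r. \<Sum>b<n. E $$ (i * n + a, j * n + b) * v $ (j * n + b)))\<^sup>2)"
      by (simp only: sum_lessThan_mult)
    also have "\<dots> = (\<Sum>i<s. \<Sum>a<n. (cmod (\<Sum>j<r. \<Sum>b<n. (Q $$ (i, j)) z $$ (a, b) * v $ (j * n + b)))\<^sup>2)"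
      by (intro sum.cong refl arg_cong[where f = "\<lambda>t. (cmod t)\<^sup>2"]) (simp add: entry)
    finally show ?thesis .
  qed
  have norm': "(l2_norm_vec v)\<^sup>2 = (\<Sum>j<r. \<Sum>b<n. (cmod (v $ (j * n + b)))\<^sup>2)"
    if "v \<in> carrier_vec (r * n)" for v
    using that by (simp add: l2_norm_vec_sq sum_lessThan_mult carrier_vecD)
  have "op_norm_mat E \<le> c \<longleftrightarrow> (\<forall>v\<in>carrier_vec (r * n). (l2_norm_vec (E *\<^sub>v v))\<^sup>2 \<le> c\<^sup>2 * (l2_norm_vec v)\<^sup>2)"
    using op_norm_mat_le_iff[OF c, of E] Ec by simp
  also have "\<dots> \<longleftrightarrow> block_norm_le (\<lambda>i j. (Q $$ (i, j)) z) s r n c"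
  proof
    assume L: "\<forall>v\<in>carrier_vec (r * n). (l2_norm_vec (E *\<^sub>v v))\<^sup>2 \<le> c\<^sup>2 * (l2_norm_vec v)\<^sup>2"
    show "block_norm_le (\<lambda>i j. (Q $$ (i, j)) z) s r n c"
      unfolding block_norm_le_def
    proof
      fix V :: "nat \<Rightarrow> nat \<Rightarrow> complex"
      \<comment> \<open>Only the entries of \<open>V\<close> with j < r and b < n survive in
        \<open>v\<close>, and only they occur in the inequality.\<close>
      define v where "v = vec (r * n) (\<lambda>k. V (k div n) (k mod n))"
      have v: "v \<in> carrier_vec (r * n)" by (simp add: v_def)
      have vV: "v $ (j * n + b) = V j b" if "j < r" "b < n" for j b
        using that lt[OF that] by (simp add: v_def)
      show "(\<Sum>i<s. \<Sum>a<n. (cmod (\<Sum>j<r. \<Sum>b<n. (Q $$ (i, j)) z $$ (a, b) * V j b))\<^sup>2)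
          \<le> c\<^sup>2 * (\<Sum>j<r. \<Sum>b<n. (cmod (V j b))\<^sup>2)"
        using bspec[OF L v] unfolding norm[OF v] norm'[OF v] by (simp add: vV)
    qed
  next
    assume "block_norm_le (\<lambda>i j. (Q $$ (i, j)) z) s r n c"
    then show "\<forall>v\<in>carrier_vec (r * n). (l2_norm_vec (E *\<^sub>v v))\<^sup>2 \<le> c\<^sup>2 * (l2_norm_vec v)\<^sup>2"
      unfolding block_norm_le_def by (auto simp only: norm norm')
  qed
  finally show ?thesis by (simp add: E_def s_def r_def)
qed

text \<open>A block matrix whose blocks are direct sums is, up to a permutation of coordinates, the
  direct sum of two block matrices. In the coordinates (i, a) the permutation disappears, and both
  squared norms simply add.\<close>

lemma block_norm_le_direct_sum:
  assumes F: "\<And>i j. i < s \<Longrightarrow> j < r \<Longrightarrow> F i j = direct_sum_mat (G i j) (H i j)"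
    and G: "\<And>i j. i < s \<Longrightarrow> j < r \<Longrightarrow> G i j \<in> carrier_mat n n"
    and H: "\<And>i j. i < s \<Longrightarrow> j < r \<Longrightarrow> H i j \<in> carrier_mat m m"
  shows "block_norm_le F s r (n + m) c \<longleftrightarrow> block_norm_le G s r n c \<and> block_norm_le H s r m c"
proof -
  define \<Phi> where "\<Phi> F k V = (\<Sum>i<s. \<Sum>a<k. (cmod (\<Sum>j<r. \<Sum>b<k. F i j $$ (a, b) * V j b))\<^sup>2)"
    for F :: "nat \<Rightarrow> nat \<Rightarrow> complex mat" and k and V :: "nat \<Rightarrow> nat \<Rightarrow> complex"
  define \<Psi> where "\<Psi> k V = (\<Sum>j<r. \<Sum>b<k. (cmod (V j b))\<^sup>2)" for k and V :: "nat \<Rightarrow> nat \<Rightarrow> complex"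
  have blk: "block_norm_le F s r k c \<longleftrightarrow> (\<forall>V. \<Phi> F k V \<le> c\<^sup>2 * \<Psi> k V)" for F k
    by (simp add: block_norm_le_def \<Phi>_def \<Psi>_def)
  have \<Psi>_add: "\<Psi> (n + m) V = \<Psi> n V + \<Psi> m (\<lambda>j b. V j (n + b))" for V
    by (simp add: \<Psi>_def sum_lessThan_add sum.distrib)
  have e: "F i j $$ (a, b) = (if a < n then if b < n then G i j $$ (a, b) else 0
      else if b < n then 0 else H i j $$ (a - n, b - n))"
    if "i < s" "j < r" "a < n + m" "b < n + m" for i j a b
    using F[OF that(1,2)] G[OF that(1,2)] H[OF that(1,2)] that(3-) by (auto simp: direct_sum_mat_def)
  have \<Phi>_add: "\<Phi> F (n + m) V = \<Phi> G n V + \<Phi> H m (\<lambda>j b. V j (n + b))" for V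
  proof -
    have 1: "(\<Sum>j<r. \<Sum>b<n + m. F i j $$ (a, b) * V j b) = (\<Sum>j<r. \<Sum>b<n. G i j $$ (a, b) * V j b)"
      if "i < s" "a < n" for i a
      unfolding sum_lessThan_add using that by (intro sum.cong refl) (simp add: e)
    have 2: "(\<Sum>j<r. \<Sum>b<n + m. F i j $$ (n + a, b) * V j b) = (\<Sum>j<r. \<Sum>b<m. H i j $$ (a, b) * V j (n + b))"
      if "i < s" "a < m" for i a
      unfolding sum_lessThan_add using that by (intro sum.cong refl) (simp add: e)
    show ?thesis
      unfolding \<Phi>_def sum.distrib[symmetric]
    proof (rule sum.cong[OF refl])
      fix i assume "i \<in> {..<s}"
      then show "(\<Sum>a<n + m. (cmod (\<Sum>j<r. \<Sum>b<n + m. F i j $$ (a, b) * V j b))\<^sup>2)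
        = (\<Sum>a<n. (cmod (\<Sum>j<r. \<Sum>b<n. G i j $$ (a, b) * V j b))\<^sup>2)
          + (\<Sum>a<m. (cmod (\<Sum>j<r. \<Sum>b<m. H i j $$ (a, b) * V j (n + b)))\<^sup>2)"
        by (subst sum_lessThan_add) (simp add: 1 2)
    qed
  qed
  show ?thesis
  proof
    assume L: "block_norm_le F s r (n + m) c"
    have "\<Phi> G n V \<le> c\<^sup>2 * \<Psi> n V" for V
    proof -
      \<comment> \<open>Zero padding: a test vector supported on the first summand isolates the
        inequality for \<open>G\<close>. Below, one supported on the second summand does so for
        \<open>H\<close>.\<close>
      define U where "U = (\<lambda>j b. if b < n then V j b else 0)"
      have "\<Phi> G n U = \<Phi> G n V" "\<Psi> n U = \<Psi> n V" "\<Phi> H m (\<lambda>j b. U j (n + b)) = 0" "\<Psi> m (\<lambda>j b. U j (n + b)) = 0"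
        by (simp_all add: \<Phi>_def \<Psi>_def U_def)
      then show ?thesis using L blk \<Phi>_add[of U] \<Psi>_add[of U] by (metis add.right_neutral)
    qed
    moreover have "\<Phi> H m V \<le> c\<^sup>2 * \<Psi> m V" for V
    proof -
      define U where "U = (\<lambda>j b. if b < n then 0 else V j (b - n))"
      have "\<Phi> G n U = 0" "\<Psi> n U = 0" "(\<lambda>j b. U j (n + b)) = V"
        by (simp_all add: \<Phi>_def \<Psi>_def U_def)
      then show ?thesis using L blk \<Phi>_add[of U] \<Psi>_add[of U] by (metis add.left_neutral)
    qed
    ultimately show "block_norm_le G s r n c \<and> block_norm_le H s r m c" by (simp add: blk)
  next
    assume "block_norm_le G s r n c \<and> block_norm_le H s r m c"
    then show "block_norm_le F s r (n + m) c"
      unfolding blk \<Phi>_add \<Psi>_add distrib_left by (blast intro: add_mono)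
  qed
qed

section \<open>Averaging a block matrix with a unitary conjugate\<close>

lemma norm_sq_convex:
  fixes x y :: complex
  assumes "0 \<le> \<alpha>" "0 \<le> \<beta>" "\<alpha> + \<beta> = 1"
  shows "(cmod (of_real \<alpha> * x + of_real \<beta> * y))\<^sup>2 \<le> \<alpha> * (cmod x)\<^sup>2 + \<beta> * (cmod y)\<^sup>2"
proof -
  have "cmod (of_real \<alpha> * x + of_real \<beta> * y) \<le> \<alpha> * cmod x + \<beta> * cmod y"
    using norm_triangle_ineq[of "of_real \<alpha> * x" "of_real \<beta> * y"] assms by (simp add: norm_mult)
  then have "(cmod (of_real \<alpha> * x + of_real \<beta> * y))\<^sup>2 \<le> (\<alpha> * cmod x + \<beta> * cmod y)\<^sup>2"
    by (intro power_mono) auto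
  \<comment> \<open>Convexity of the square with its exact defect, which is nonnegative and is
    dropped afterwards.\<close>
  also have "\<dots> = \<alpha> * (cmod x)\<^sup>2 + \<beta> * (cmod y)\<^sup>2 - \<alpha> * \<beta> * (cmod x - cmod y)\<^sup>2"
  proof -
    have "\<beta> = 1 - \<alpha>" using assms by simp
    then show ?thesis by (simp only:) (simp add: power2_eq_square algebra_simps)
  qed
  also have "\<dots> \<le> \<alpha> * (cmod x)\<^sup>2 + \<beta> * (cmod y)\<^sup>2" using assms by simp
  finally show ?thesis .
qed

lemma smult_mat_mult_vec:
  fixes B :: "complex mat"
  assumes "B \<in> carrier_mat m n" "v \<in> carrier_vec n"
  shows "(c \<cdot>\<^sub>m B) *\<^sub>v v = c \<cdot>\<^sub>v (B *\<^sub>v v)"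
  using assms by (intro eq_vecI) auto

text \<open>\<open>W\<close> is unitary, so conjugating every block by it preserves the norm bound,
  and a convex combination of two operators with the same bound has that bound again.\<close>

lemma block_norm_le_convex_conj:
  assumes F: "block_norm_le F s r n c" and Fc: "\<And>i j. i < s \<Longrightarrow> j < r \<Longrightarrow> F i j \<in> carrier_mat n n"
    and W: "W \<in> carrier_mat n n" and WW: "W * W = 1\<^sub>m n"
    and herm: "\<And>a b. a < n \<Longrightarrow> b < n \<Longrightarrow> W $$ (b, a) = cnj (W $$ (a, b))"
    and ab: "0 \<le> \<alpha>" "0 \<le> \<beta>" "\<alpha> + \<beta> = 1"
    and F': "\<And>i j. i < s \<Longrightarrow> j < r \<Longrightarrow>
      F' i j = of_real \<alpha> \<cdot>\<^sub>m F i j + of_real \<beta> \<cdot>\<^sub>m (W * (F i j * W))"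
  shows "block_norm_le F' s r n c"
  unfolding block_norm_le_def
proof
  fix V :: "nat \<Rightarrow> nat \<Rightarrow> complex"
  \<comment> \<open>\<open>U\<close> is \<open>V\<close> with \<open>W\<close> applied to each
    component, and \<open>X V\<close> is the image of \<open>V\<close> under the block operator.
    Both applications of \<open>W\<close> are then isometric.\<close>
  define U where "U = (\<lambda>j d. \<Sum>b<n. W $$ (d, b) * V j b)"
  define X where "X = (\<lambda>V i a. \<Sum>j<r. \<Sum>b<n. F i j $$ (a, b) * V j b)"
  have act: "(\<Sum>j<r. \<Sum>b<n. F' i j $$ (a, b) * V j b)
      = of_real \<alpha> * X V i a + of_real \<beta> * (\<Sum>d<n. W $$ (a, d) * X U i d)" if i: "i < s" and a: "a < n" for i a
  proof -
    have "(\<Sum>b<n. F' i j $$ (a, b) * V j b) = of_real \<alpha> * (\<Sum>b<n. F i j $$ (a, b) * V j b)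
        + of_real \<beta> * (\<Sum>d<n. W $$ (a, d) * (\<Sum>e<n. F i j $$ (d, e) * U j e))" if j: "j < r" for j
    proof -
      define v where "v = vec n (V j)"
      have v: "v \<in> carrier_vec n" by (simp add: v_def)
      have mv: "(B *\<^sub>v w) $ a = (\<Sum>b<n. B $$ (a, b) * w $ b)"
        if "B \<in> carrier_mat n n" "w \<in> carrier_vec n" "a < n" for B :: "complex mat" and w a
        using that by (auto simp: scalar_prod_def atLeast0LessThan intro!: sum.cong)
      have C: "F i j \<in> carrier_mat n n" by (rule Fc[OF i j])
      have FW: "F i j * W \<in> carrier_mat n n" "W * (F i j * W) \<in> carrier_mat n n" using C W by auto
      have "F' i j *\<^sub>v v = of_real \<alpha> \<cdot>\<^sub>v (F i j *\<^sub>v v) + of_real \<beta> \<cdot>\<^sub>v (W *\<^sub>v (F i j *\<^sub>v (W *\<^sub>v v)))"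
        unfolding F'[OF i j] using C W FW v
        by (simp add: add_mult_distrib_mat_vec[of _ n n] smult_mat_mult_vec[of _ n n]
            assoc_mult_mat_vec[of _ n n _ n])
      then have "(F' i j *\<^sub>v v) $ a = of_real \<alpha> * (F i j *\<^sub>v v) $ a + of_real \<beta> * (W *\<^sub>v (F i j *\<^sub>v (W *\<^sub>v v))) $ a"
        using a C W by simp
      moreover have "F' i j \<in> carrier_mat n n" unfolding F'[OF i j] using C FW by simp
      moreover have "(W *\<^sub>v v) $ e = U j e" if "e < n" for e
        using mv[OF W v that] by (simp add: U_def v_def)
      ultimately show ?thesis
        using mv[of "F' i j" v a] mv[OF C v a] mv[OF W, of "F i j *\<^sub>v (W *\<^sub>v v)" a] mv[OF C, of "W *\<^sub>v v"] a C W v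
        by (simp add: v_def)
    qed
    then have "(\<Sum>j<r. \<Sum>b<n. F' i j $$ (a, b) * V j b) = of_real \<alpha> * X V i a
        + of_real \<beta> * (\<Sum>j<r. \<Sum>d<n. W $$ (a, d) * (\<Sum>e<n. F i j $$ (d, e) * U j e))"
      by (simp add: X_def sum.distrib sum_distrib_left)
    also have "(\<Sum>j<r. \<Sum>d<n. W $$ (a, d) * (\<Sum>e<n. F i j $$ (d, e) * U j e)) = (\<Sum>d<n. W $$ (a, d) * X U i d)"
      unfolding X_def by (subst sum.swap) (simp add: sum_distrib_left)
    finally show ?thesis .
  qed
  note iso = hermitian_involution_isometry[OF W WW herm]
  have bd: "(\<Sum>i<s. \<Sum>a<n. (cmod (X V i a))\<^sup>2) \<le> c\<^sup>2 * (\<Sum>j<r. \<Sum>b<n. (cmod (V j b))\<^sup>2)" for V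
    using F by (simp add: block_norm_le_def X_def)
  have "(\<Sum>i<s. \<Sum>a<n. (cmod (\<Sum>j<r. \<Sum>b<n. F' i j $$ (a, b) * V j b))\<^sup>2)
      \<le> (\<Sum>i<s. \<Sum>a<n. \<alpha> * (cmod (X V i a))\<^sup>2 + \<beta> * (cmod (\<Sum>d<n. W $$ (a, d) * X U i d))\<^sup>2)"
    by (intro sum_mono) (simp add: act norm_sq_convex[OF ab])
  also have "\<dots> = \<alpha> * (\<Sum>i<s. \<Sum>a<n. (cmod (X V i a))\<^sup>2) + \<beta> * (\<Sum>i<s. \<Sum>a<n. (cmod (X U i a))\<^sup>2)"
    by (simp only: sum.distrib sum_distrib_left[symmetric] iso)
  also have "\<dots> \<le> \<alpha> * (c\<^sup>2 * (\<Sum>j<r. \<Sum>b<n. (cmod (V j b))\<^sup>2)) + \<beta> * (c\<^sup>2 * (\<Sum>j<r. \<Sum>b<n. (cmod (U j b))\<^sup>2))"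
    using ab by (intro add_mono mult_left_mono bd) auto
  also have "(\<Sum>j<r. \<Sum>b<n. (cmod (U j b))\<^sup>2) = (\<Sum>j<r. \<Sum>b<n. (cmod (V j b))\<^sup>2)"
    by (simp only: U_def iso)
  also have "\<alpha> * (c\<^sup>2 * (\<Sum>j<r. \<Sum>b<n. (cmod (V j b))\<^sup>2)) + \<beta> * (c\<^sup>2 * (\<Sum>j<r. \<Sum>b<n. (cmod (V j b))\<^sup>2))
      = (\<alpha> + \<beta>) * (c\<^sup>2 * (\<Sum>j<r. \<Sum>b<n. (cmod (V j b))\<^sup>2))" by (simp only: distrib_right)
  finally show "(\<Sum>i<s. \<Sum>a<n. (cmod (\<Sum>j<r. \<Sum>b<n. F' i j $$ (a, b) * V j b))\<^sup>2)
      \<le> c\<^sup>2 * (\<Sum>j<r. \<Sum>b<n. (cmod (V j b))\<^sup>2)" using ab by simp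
qed

section \<open>Basic free sets and direct sums of points\<close>

lemma nc_algebraD:
  assumes "nc_algebra scale \<Xi> A" "p \<in> A"
  shows "nc_function scale \<Xi> p"
    and "q \<in> A \<Longrightarrow> (\<lambda>x\<in>\<Xi>. p x + q x) \<in> A"
    and "(\<lambda>x\<in>\<Xi>. c \<cdot>\<^sub>m p x) \<in> A"
    and "q \<in> A \<Longrightarrow> (\<lambda>x\<in>\<Xi>. p x * q x) \<in> A"
  using assms by (auto simp: nc_algebra_def)

text \<open>The entries of \<open>P\<close> respect direct sums, so the norm at the direct sum is
  the maximum of the two norms. The evaluated matrix is only a shuffle of a direct sum, so the norms
  are compared through their nonnegative upper bounds in the form
  \<open>block_norm_le\<close>.\<close>

lemma basic_free_set_direct_sum_iff:
  assumes vs: "vector_space scale" and \<Xi>: "nc_set \<Xi>" and A: "nc_algebra scale \<Xi> A" and P: "matrix_over A P"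
    and x: "x \<in> \<Xi>" and y: "y \<in> \<Xi>"
  shows "direct_sum_mat x y \<in> basic_free_set \<Xi> P \<longleftrightarrow> x \<in> basic_free_set \<Xi> P \<and> y \<in> basic_free_set \<Xi> P"
proof -
  let ?z = "direct_sum_mat x y"
  let ?N = "\<lambda>z. op_norm_mat (eval_matrix P z)"
  have z: "?z \<in> \<Xi>" using \<Xi> x y by (auto simp: nc_set_def)
  have sp: "x \<in> nc_space" "y \<in> nc_space" using \<Xi> x y by (auto simp: nc_set_def)
  have pos: "0 < dim_row x" "0 < dim_row y" "dim_row ?z = dim_row x + dim_row y"
    using sp by (auto simp: nc_space_def direct_sum_mat_def)
  have nc: "nc_function scale \<Xi> (P $$ (i, j))" if "i < dim_row P" "j < dim_col P" for i j
    using P that by (intro nc_algebraD[OF A]) (auto simp: matrix_over_def)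
  have le_iff: "?N ?z \<le> c \<longleftrightarrow> ?N x \<le> c \<and> ?N y \<le> c" if "0 \<le> c" for c
    unfolding op_norm_eval_matrix_le_iff[OF that pos(3) trans_less_add1[OF pos(1)]]
      op_norm_eval_matrix_le_iff[OF that refl pos(1)] op_norm_eval_matrix_le_iff[OF that refl pos(2)]
    by (intro block_norm_le_direct_sum nc_function_direct_sum[OF vs nc \<Xi> x y]
        nc_function_carrier[OF nc x sp(1)] nc_function_carrier[OF nc y sp(2)])
  have "?N ?z = max (?N x) (?N y)"
  proof (rule antisym)
    show "?N ?z \<le> max (?N x) (?N y)"
      by (subst le_iff) (auto simp: le_max_iff_disj op_norm_mat_nonneg)
    show "max (?N x) (?N y) \<le> ?N ?z"
      using le_iff[OF op_norm_mat_nonneg, of "eval_matrix P ?z"] by simp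
  qed
  then show ?thesis using x y z by (simp add: basic_free_set_def)
qed

lemma nc_set_basic_free_set:
  assumes "vector_space scale" "nc_set \<Xi>" "nc_algebra scale \<Xi> A" "matrix_over A P"
  shows "nc_set (basic_free_set \<Xi> P)"
  unfolding nc_set_def
  using assms(2) basic_free_set_direct_sum_iff[OF assms]
  by (auto simp: nc_set_def basic_free_set_def)

section \<open>Conjugation by perturbations of the identity along a projection\<close>

lemma eq_mat_mult_vecI:
  fixes B C :: "complex mat"
  assumes B: "B \<in> carrier_mat m n" and C: "C \<in> carrier_mat m n"
    and eq: "\<And>v. v \<in> carrier_vec n \<Longrightarrow> B *\<^sub>v v = C *\<^sub>v v"
  shows "B = C"
proof (rule eq_matI)
  fix i j assume "i < dim_row C" "j < dim_col C"
  then have ij: "i < m" "j < n" using C by auto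
  have "(B *\<^sub>v unit_vec n j) $ i = (C *\<^sub>v unit_vec n j) $ i" using eq by simp
  then show "B $$ (i, j) = C $$ (i, j)" using B C ij by simp
qed (use B C in auto)

text \<open>For idempotent P this multiplies the range of P by 1 + c and is the identity on the
  kernel. The values c = t - 1, 1/t - 1, -1 and -2 give a dilation, its inverse, the complementary
  projection and a reflection.\<close>

definition one_plus_smult :: "nat \<Rightarrow> complex mat \<Rightarrow> complex \<Rightarrow> complex mat" where
  "one_plus_smult n P c = 1\<^sub>m n + c \<cdot>\<^sub>m P"

lemma one_plus_smult_carrier [simp]: "P \<in> carrier_mat n n \<Longrightarrow> one_plus_smult n P c \<in> carrier_mat n n"
  by (simp add: one_plus_smult_def)

text \<open>The hypothesis says that B leaves the range of P invariant; it turns the term P B P of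
  the expansion into B P.\<close>

lemma one_plus_smult_sandwich:
  assumes P: "P \<in> carrier_mat n n" and B: "B \<in> carrier_mat n n" and PBP: "P * (B * P) = B * P"
  shows "one_plus_smult n P c * (B * one_plus_smult n P d) = B + ((d + c * d) \<cdot>\<^sub>m (B * P) + c \<cdot>\<^sub>m (P * B))"
proof -
  have X: "P * B \<in> carrier_mat n n" and Y: "B * P \<in> carrier_mat n n" using P B by auto
  have 1: "B * one_plus_smult n P d = B + d \<cdot>\<^sub>m (B * P)"
    unfolding one_plus_smult_def using B
    by (simp add: mult_add_distrib_mat[OF B one_carrier_mat smult_carrier_mat[OF P]] mult_smult_distrib[OF B P])
  have 2: "one_plus_smult n P c * Z = Z + c \<cdot>\<^sub>m (P * Z)" if "Z \<in> carrier_mat n n" for Z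
    unfolding one_plus_smult_def using that
    by (simp add: add_mult_distrib_mat[OF one_carrier_mat smult_carrier_mat[OF P] that] mult_smult_assoc_mat[OF P that])
  have 3: "P * (B + d \<cdot>\<^sub>m (B * P)) = P * B + d \<cdot>\<^sub>m (B * P)"
    by (simp add: mult_add_distrib_mat[OF P B smult_carrier_mat[OF Y]] mult_smult_distrib[OF P Y] PBP)
  have "B + d \<cdot>\<^sub>m (B * P) \<in> carrier_mat n n" using B Y by simp
  then have "one_plus_smult n P c * (B * one_plus_smult n P d)
      = B + d \<cdot>\<^sub>m (B * P) + c \<cdot>\<^sub>m (P * B + d \<cdot>\<^sub>m (B * P))"
    by (simp add: 1 2 3)
  also have "\<dots> = B + ((d + c * d) \<cdot>\<^sub>m (B * P) + c \<cdot>\<^sub>m (P * B))"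
  proof -
    have "B + d \<cdot>\<^sub>m Y + c \<cdot>\<^sub>m (X + d \<cdot>\<^sub>m Y) = B + ((d + c * d) \<cdot>\<^sub>m Y + c \<cdot>\<^sub>m X)"
      if "X \<in> carrier_mat n n" "Y \<in> carrier_mat n n" for X Y
      by (rule eq_matI) (use B that in \<open>auto simp: algebra_simps\<close>)
    from this[OF X Y] show ?thesis .
  qed
  finally show ?thesis .
qed

text \<open>The factors on the range multiply: c + d + c d is (1 + c)(1 + d) - 1. This is the
  sandwich with B = 1, where invariance becomes idempotence.\<close>

lemma one_plus_smult_mult:
  assumes P: "P \<in> carrier_mat n n" and PP: "P * P = P"
  shows "one_plus_smult n P c * one_plus_smult n P d = one_plus_smult n P (c + d + c * d)"
proof -
  have "one_plus_smult n P c * (1\<^sub>m n * one_plus_smult n P d)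
      = 1\<^sub>m n + ((d + c * d) \<cdot>\<^sub>m (1\<^sub>m n * P) + c \<cdot>\<^sub>m (P * 1\<^sub>m n))"
    by (rule one_plus_smult_sandwich[OF P]) (use P PP in auto)
  also have "\<dots> = one_plus_smult n P (c + d + c * d)"
    by (rule eq_matI) (use P in \<open>auto simp: one_plus_smult_def algebra_simps\<close>)
  finally show ?thesis using left_mult_one_mat[OF one_plus_smult_carrier[OF P, of d]] by simp
qed

lemma one_plus_smult_zero: "P \<in> carrier_mat n n \<Longrightarrow> one_plus_smult n P 0 = 1\<^sub>m n"
  by (rule eq_matI) (auto simp: one_plus_smult_def)

lemma one_plus_smult_mult_vec:
  assumes "P \<in> carrier_mat n n" "v \<in> carrier_vec n"
  shows "one_plus_smult n P c *\<^sub>v v = v + c \<cdot>\<^sub>v (P *\<^sub>v v)"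
  using assms by (simp add: one_plus_smult_def add_mult_distrib_mat_vec[of _ n n] smult_mat_mult_vec[of _ n n])

lemma l2_norm_vec_eq_0: "l2_norm_vec v = 0 \<Longrightarrow> v = 0\<^sub>v (dim_vec v)"
proof (rule eq_vecI)
  fix i assume z: "l2_norm_vec v = 0" and "i < dim_vec (0\<^sub>v (dim_vec v) :: complex vec)"
  then have i: "i < dim_vec v" by simp
  have "(\<Sum>i<dim_vec v. (cmod (v $ i))\<^sup>2) = 0" using l2_norm_vec_sq[of v] z by simp
  then show "v $ i = 0\<^sub>v (dim_vec v) $ i" using i by (simp add: sum_nonneg_eq_0_iff)
qed simp

section \<open>Iterated direct sums\<close>

text \<open>There is no empty direct sum in an nc set, so index k stands for k + 1 summands.
  \<open>stack\<close> below follows the same count, with the last vector on top.\<close>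

fun copies :: "'a::zero mat \<Rightarrow> nat \<Rightarrow> 'a mat" where
  "copies x 0 = x"
| "copies x (Suc k) = direct_sum_mat x (copies x k)"

fun stack :: "(nat \<Rightarrow> complex vec) \<Rightarrow> nat \<Rightarrow> complex vec" where
  "stack u 0 = u 0"
| "stack u (Suc k) = u (Suc k) @\<^sub>v stack u k"

lemma copies_mem: "nc_set \<Omega> \<Longrightarrow> x \<in> \<Omega> \<Longrightarrow> copies x k \<in> \<Omega>"
  by (induction k) (auto simp: nc_set_def)

lemma nc_function_copies:
  assumes "vector_space scale" "nc_function scale \<Omega> f" "nc_set \<Omega>" "x \<in> \<Omega>"
  shows "f (copies x k) = copies (f x) k"
  by (induction k) (simp_all add: nc_function_direct_sum[OF assms] copies_mem assms)

lemma copies_carrier: "x \<in> carrier_mat n n \<Longrightarrow> copies x k \<in> carrier_mat (Suc k * n) (Suc k * n)"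
  by (induction k) (auto simp: direct_sum_mat_def)

lemma stack_carrier: "(\<And>i. u i \<in> carrier_vec n) \<Longrightarrow> stack u k \<in> carrier_vec (Suc k * n)"
  by (induction k) auto

lemma copies_mult_stack:
  assumes T: "T \<in> carrier_mat n n" and u: "\<And>i. u i \<in> carrier_vec n"
  shows "copies T k *\<^sub>v stack u k = stack (\<lambda>i. T *\<^sub>v u i) k"
proof (induction k)
  case (Suc k)
  have "direct_sum_mat T (copies T k) *\<^sub>v (u (Suc k) @\<^sub>v stack u k) = (T *\<^sub>v u (Suc k)) @\<^sub>v (copies T k *\<^sub>v stack u k)"
    by (rule direct_sum_mat_mult_append) (use T u copies_carrier[OF T, of k] stack_carrier[of u n k] in auto)
  then show ?case using Suc by simp
qed simp

lemma stack_inject: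
  assumes "stack u k = stack w k" "i \<le> k" and "\<And>i. u i \<in> carrier_vec n" "\<And>i. w i \<in> carrier_vec n"
  shows "u i = w i"
  using assms(1,2)
proof (induction k)
  case (Suc k)
  then have "u (Suc k) = w (Suc k) \<and> stack u k = stack w k"
    using append_vec_eq[OF assms(3) assms(4)] by simp
  then show ?case using Suc by (cases "i = Suc k") auto
qed simp

section \<open>Nc sets generated by points, and cancellation in direct sums\<close>

inductive_set nc_hull :: "'a::zero mat set \<Rightarrow> 'a mat set" for X where
  base: "x \<in> X \<Longrightarrow> x \<in> nc_hull X"
| sum: "x \<in> nc_hull X \<Longrightarrow> y \<in> nc_hull X \<Longrightarrow> direct_sum_mat x y \<in> nc_hull X"

lemma nc_hull_subset:
  assumes "nc_set \<Omega>" "X \<subseteq> \<Omega>"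
  shows "nc_hull X \<subseteq> \<Omega>"
proof
  fix x assume "x \<in> nc_hull X"
  then show "x \<in> \<Omega>" by induction (use assms in \<open>auto simp: nc_set_def\<close>)
qed

lemma nc_set_nc_hull: "nc_set \<Omega> \<Longrightarrow> X \<subseteq> \<Omega> \<Longrightarrow> nc_set (nc_hull X)"
  using nc_hull_subset[of \<Omega> X] by (auto simp: nc_set_def intro: nc_hull.sum)

lemma direct_sum_mat_inject:
  assumes "B \<in> carrier_mat n n" "B' \<in> carrier_mat n n" "C \<in> carrier_mat m m" "C' \<in> carrier_mat m m"
    and eq: "direct_sum_mat B C = direct_sum_mat B' C'"
  shows "B = B' \<and> C = C'"
proof (intro conjI eq_matI)
  fix i j assume "i < dim_row B'" "j < dim_col B'"
  then show "B $$ (i, j) = B' $$ (i, j)"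
    using assms(1-4) arg_cong[OF eq, of "\<lambda>X. X $$ (i, j)"] by (simp add: direct_sum_mat_def)
next
  fix i j assume "i < dim_row C'" "j < dim_col C'"
  then show "C $$ (i, j) = C' $$ (i, j)"
    using assms(1-4) arg_cong[OF eq, of "\<lambda>X. X $$ (n + i, n + j)"] by (simp add: direct_sum_mat_def)
qed (use assms in auto)

section \<open>Compact nc sets\<close>

context
  fixes scale :: "complex \<Rightarrow> 'v::ab_group_add \<Rightarrow> 'v"
    and \<Xi> :: "'v mat set" and A :: "('v mat \<Rightarrow> complex mat) set"
  assumes vs: "vector_space scale" and full: "full_nc_set scale \<Xi>" and alg: "nc_algebra scale \<Xi> A"
begin

private lemma nc: "nc_set \<Xi>" using full by (simp add: full_nc_set_def)

lemma openin_basic_free_set: "matrix_over A P \<Longrightarrow> openin (free_topology \<Xi> A) (basic_free_set \<Xi> P)"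
  unfolding openin_free_topology[OF nc alg] by (rule arbitrary_union_of_inc) blast

lemma openin_free_topologyD:
  assumes "openin (free_topology \<Xi> A) U" "x \<in> U"
  obtains P where "matrix_over A P" "x \<in> basic_free_set \<Xi> P" "basic_free_set \<Xi> P \<subseteq> U"
  using assms unfolding openin_free_topology[OF nc alg] arbitrary_union_of_alt by blast

lemma compactin_nc_hull_pair:
  assumes "x \<in> basic_free_set \<Xi> Q" "y \<in> basic_free_set \<Xi> Q" "matrix_over A Q"
  shows "compactin (free_topology \<Xi> A) (nc_hull {x, y})"
  unfolding compactin_def
proof (intro conjI allI impI)
  have hull: "nc_hull {x, y} \<subseteq> basic_free_set \<Xi> P"
    if "matrix_over A P" "x \<in> basic_free_set \<Xi> P" "y \<in> basic_free_set \<Xi> P" for P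
    by (rule nc_hull_subset[OF nc_set_basic_free_set[OF vs nc alg that(1)]]) (use that in auto)
  show "nc_hull {x, y} \<subseteq> topspace (free_topology \<Xi> A)"
    using hull[OF assms(3,1,2)] openin_subset[OF openin_basic_free_set[OF assms(3)]] by blast
  fix \<U> assume \<U>: "(\<forall>U\<in>\<U>. openin (free_topology \<Xi> A) U) \<and> nc_hull {x, y} \<subseteq> \<Union>\<U>"
  \<comment> \<open>The member of the cover that contains this one point already covers the hull: a
    basic set around the direct sum contains x and y as well.\<close>
  have "direct_sum_mat x y \<in> nc_hull {x, y}" by (auto intro: nc_hull.intros)
  then obtain U where U: "U \<in> \<U>" "direct_sum_mat x y \<in> U" using \<U> by blast
  then obtain P where P: "matrix_over A P" "direct_sum_mat x y \<in> basic_free_set \<Xi> P" "basic_free_set \<Xi> P \<subseteq> U"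
    using \<U> by (metis openin_free_topologyD)
  moreover have "x \<in> \<Xi>" "y \<in> \<Xi>" using assms by (auto simp: basic_free_set_def)
  ultimately have "nc_hull {x, y} \<subseteq> U"
    using hull[OF P(1)] basic_free_set_direct_sum_iff[OF vs nc alg P(1)] by blast
  then show "\<exists>\<F>. finite \<F> \<and> \<F> \<subseteq> \<U> \<and> nc_hull {x, y} \<subseteq> \<Union>\<F>"
    using U by (intro exI[of _ "{U}"]) auto
qed

lemma compact_nc_set_subset_basic:
  assumes K: "nc_set K" "K \<subseteq> \<Xi>" "K \<noteq> {}" "compactin (free_topology \<Xi> A) K"
    and R: "\<And>P. P \<in> \<R> \<Longrightarrow> matrix_over A P" and cover: "K \<subseteq> (\<Union>P\<in>\<R>. basic_free_set \<Xi> P)"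
  obtains P where "P \<in> \<R>" "K \<subseteq> basic_free_set \<Xi> P"
proof -
  have "\<exists>\<F>. finite \<F> \<and> \<F> \<subseteq> basic_free_set \<Xi> ` \<R> \<and> K \<subseteq> \<Union>\<F>"
    using K(4) cover R openin_basic_free_set unfolding compactin_def by (metis (no_types, lifting) imageE)
  then obtain S where S: "finite S" "S \<subseteq> \<R>" "K \<subseteq> (\<Union>P\<in>S. basic_free_set \<Xi> P)"
    by (metis finite_subset_image)
  have "\<exists>P\<in>S. K \<subseteq> basic_free_set \<Xi> P"
  proof (rule ccontr)
    assume no: "\<not> ?thesis"
    \<comment> \<open>Strengthened to a single point omitted by all members of \<open>S\<close>, so
      that the induction adds one summand per member. Nonemptiness of \<open>K\<close> starts
      it.\<close>
    have "\<exists>x\<in>K. \<forall>P\<in>S. x \<notin> basic_free_set \<Xi> P"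
      using S(1,2) no
    proof (induction S)
      case empty
      then show ?case using K(3) by auto
    next
      case (insert P S)
      then obtain x y where xy: "x \<in> K" "\<forall>P\<in>S. x \<notin> basic_free_set \<Xi> P" "y \<in> K" "y \<notin> basic_free_set \<Xi> P"
        by auto
      have "direct_sum_mat x y \<in> K" using K(1) xy by (auto simp: nc_set_def)
      moreover have "direct_sum_mat x y \<notin> basic_free_set \<Xi> P'" if "P' \<in> insert P S" for P'
        using that insert.prems(1) xy K(2) R basic_free_set_direct_sum_iff[OF vs nc alg, of P' x y] by auto
      ultimately show ?case by blast
    qed
    then show False using S(3) by blast
  qed
  then show thesis using S(2) that by blast
qed

lemma basic_free_set_separates:
  assumes p: "p \<in> A" and l: "l \<in> \<Xi>" and m: "m \<in> \<Xi>"
    and pl: "p l = 0\<^sub>m (dim_row l) (dim_row l)" and pm: "p m \<noteq> 0\<^sub>m (dim_row m) (dim_row m)"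
  obtains P where "matrix_over A P" "l \<in> basic_free_set \<Xi> P" "m \<notin> basic_free_set \<Xi> P"
proof -
  have pos: "0 < dim_row l" "0 < dim_row m" using nc l m by (auto simp: nc_set_def nc_space_def)
  have "p m \<in> carrier_mat (dim_row m) (dim_row m)"
    using nc m by (intro nc_function_carrier[OF nc_algebraD(1)[OF alg p]]) (auto simp: nc_set_def)
  then obtain a b where ab: "a < dim_row m" "b < dim_row m" and ne: "p m $$ (a, b) \<noteq> 0"
    using pm by (metis carrier_matD eq_matI index_zero_mat)
  \<comment> \<open>The scaling makes one entry of \<open>q m\<close> equal to 2, which forces norm
    greater than 1, while \<open>q l\<close> stays zero.\<close>
  define t where "t = 2 / p m $$ (a, b)"
  define q where "q = (\<lambda>x\<in>\<Xi>. t \<cdot>\<^sub>m p x)"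
  define P where "P = mat 1 1 (\<lambda>_. q)"
  have "elements_mat P \<subseteq> {q}" by (auto simp: P_def dest!: elements_matD)
  then have "matrix_over A P" using nc_algebraD(3)[OF alg p, of t] by (auto simp: matrix_over_def q_def P_def)
  moreover have "op_norm_mat (eval_matrix P l) \<le> 0"
    using pos(1) l by (subst op_norm_eval_matrix_le_iff[OF _ refl]) (auto simp: block_norm_le_def P_def q_def pl)
  then have "l \<in> basic_free_set \<Xi> P" using l by (simp add: basic_free_set_def)
  moreover have "\<not> op_norm_mat (eval_matrix P m) \<le> 1"
  proof
    assume "op_norm_mat (eval_matrix P m) \<le> 1"
    then have "block_norm_le (\<lambda>i j. (P $$ (i, j)) m) 1 1 (dim_row m) 1"
      using op_norm_eval_matrix_le_iff[of 1 m, OF _ refl pos(2), of P] by (simp add: P_def)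
    \<comment> \<open>Testing on the basis vector with index b leaves the squared norm of column b
      of \<open>q m\<close>.\<close>
    then have "(\<Sum>c<dim_row m. (cmod (\<Sum>d<dim_row m. (P $$ (0, 0)) m $$ (c, d) * (if d = b then 1 else 0)))\<^sup>2)
        \<le> (\<Sum>d<dim_row m. (cmod (if d = b then 1 else 0))\<^sup>2)"
      unfolding block_norm_le_def by (auto dest: spec[of _ "\<lambda>_ d. if d = b then 1 else 0"])
    also have "(\<Sum>d<dim_row m. (cmod (if d = b then 1 else 0))\<^sup>2) = (\<Sum>d<dim_row m. if d = b then 1 else 0)"
      by (intro sum.cong) auto
    finally have "(\<Sum>c<dim_row m. (cmod (q m $$ (c, b)))\<^sup>2) \<le> 1"
      using ab by (simp add: P_def if_distrib[of "\<lambda>t. _ * t"] cong: if_cong)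
    moreover have "(cmod (q m $$ (a, b)))\<^sup>2 \<le> (\<Sum>c<dim_row m. (cmod (q m $$ (c, b)))\<^sup>2)"
      using ab by (intro member_le_sum) auto
    moreover have "q m $$ (a, b) = 2"
      using m ab ne \<open>p m \<in> _\<close> by (auto simp: q_def t_def)
    ultimately show False by simp
  qed
  then have "m \<notin> basic_free_set \<Xi> P" by (simp add: basic_free_set_def)
  ultimately show thesis by (rule that)
qed

text \<open>Otherwise each l in \<open>K\<close> lies in a basic set that misses some point of
  \<open>K\<close>. These sets cover \<open>K\<close>, so one of them would contain
  \<open>K\<close>.\<close>

lemma compact_nc_set_subset_zariski_closure:
  assumes K: "nc_set K" "K \<subseteq> \<Xi>" "K \<noteq> {}" "compactin (free_topology \<Xi> A) K"
  shows "\<exists>l\<in>K. K \<subseteq> zariski_closure \<Xi> A l"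
proof (rule ccontr)
  assume "\<not> ?thesis"
  then have no: "\<not> K \<subseteq> zariski_closure \<Xi> A l" if "l \<in> K" for l using that by blast
  define \<R> where "\<R> = {P. matrix_over A P \<and> \<not> K \<subseteq> basic_free_set \<Xi> P}"
  have "\<exists>P\<in>\<R>. l \<in> basic_free_set \<Xi> P" if l: "l \<in> K" for l
  proof -
    obtain m where m: "m \<in> K" "m \<notin> zariski_closure \<Xi> A l" using no[OF l] by auto
    then obtain p where p: "p \<in> A" "p l = 0\<^sub>m (dim_row l) (dim_row l)" "p m \<noteq> 0\<^sub>m (dim_row m) (dim_row m)"
      using K(2) by (auto simp: zariski_closure_def vanishing_ideal_def)
    obtain P where "matrix_over A P" "l \<in> basic_free_set \<Xi> P" "m \<notin> basic_free_set \<Xi> P"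
      using basic_free_set_separates[OF p(1) _ _ p(2,3)] l m K(2) by blast
    then show ?thesis using m by (auto simp: \<R>_def)
  qed
  then have cover: "K \<subseteq> (\<Union>P\<in>\<R>. basic_free_set \<Xi> P)" by blast
  obtain P where "P \<in> \<R>" "K \<subseteq> basic_free_set \<Xi> P"
    by (rule compact_nc_set_subset_basic[OF K _ cover]) (auto simp: \<R>_def)
  then show False by (simp add: \<R>_def)
qed

context
  fixes Q :: "('v mat \<Rightarrow> complex mat) mat"
  assumes unit: "nc_unit \<Xi> \<in> A" and Q: "matrix_over A Q"
begin

section \<open>Interpolation of bounded nc functions\<close>

lemma H_infty_agrees_on_vec:
  assumes f: "f \<in> H_infty scale (basic_free_set \<Xi> Q)" and z: "z \<in> basic_free_set \<Xi> Q"
    and zc: "z \<in> carrier_mat n n" and v: "v \<in> carrier_vec n"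
  shows "\<exists>p\<in>A. f z *\<^sub>v v = p z *\<^sub>v v"
proof -
  let ?D = "basic_free_set \<Xi> Q"
  have fnc: "nc_function scale ?D f" using f by (simp add: H_infty_def)
  have z\<Xi>: "z \<in> \<Xi>" using z by (simp add: basic_free_set_def)
  have sp: "x \<in> nc_space" if "x \<in> \<Xi>" for x using nc that by (auto simp: nc_set_def)
  have n: "0 < n" using sp[OF z\<Xi>] zc by (auto simp: nc_space_def)
  have pnc: "nc_function scale \<Xi> p" if "p \<in> A" for p by (rule nc_algebraD(1)[OF alg that])
  have pz: "p z \<in> carrier_mat n n" if "p \<in> A" for p
    using nc_function_carrier[OF pnc[OF that] z\<Xi> sp[OF z\<Xi>]] zc by simp
  have fz: "f z \<in> carrier_mat n n" using nc_function_carrier[OF fnc z sp[OF z\<Xi>]] zc by simp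
  \<comment> \<open>The cyclic subspace of v. The linear operations of \<open>A\<close> make it a
    subspace, the unit puts v into it, and products make it invariant under every
    \<open>q z\<close>.\<close>
  define M where "M = (\<lambda>p. p z *\<^sub>v v) ` A"
  have mem: "u \<in> M" if "p \<in> A" "p z *\<^sub>v v = u" for p u using that by (auto simp: M_def)
  have Mc: "M \<subseteq> carrier_vec n" using mult_mat_vec_carrier[OF pz v] by (auto simp: M_def)
  have zero: "0\<^sub>v n \<in> M"
  proof -
    have "nc_zero \<Xi> \<in> A" using alg by (simp add: nc_algebra_def)
    moreover have "nc_zero \<Xi> z *\<^sub>v v = 0\<^sub>v n"
      using z\<Xi> zc v by (intro eq_vecI) (auto simp: nc_zero_def)
    ultimately show ?thesis by (rule mem)
  qed
  have vM: "v \<in> M"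
  proof -
    have "nc_unit \<Xi> z *\<^sub>v v = v" using z\<Xi> zc v by (simp add: nc_unit_def)
    then show ?thesis by (rule mem[OF unit])
  qed
  have add: "u + w \<in> M" if uw: "u \<in> M" "w \<in> M" for u w
  proof -
    obtain p q where p: "p \<in> A" "u = p z *\<^sub>v v" and q: "q \<in> A" "w = q z *\<^sub>v v"
      using uw by (auto simp: M_def)
    have "(\<lambda>x\<in>\<Xi>. p x + q x) z *\<^sub>v v = u + w"
      using add_mult_distrib_mat_vec[OF pz[OF p(1)] pz[OF q(1)] v] z\<Xi> p q by simp
    then show ?thesis by (rule mem[OF nc_algebraD(2)[OF alg p(1) q(1)]])
  qed
  have smult: "c \<cdot>\<^sub>v u \<in> M" if u: "u \<in> M" for c u
  proof -
    obtain p where p: "p \<in> A" "u = p z *\<^sub>v v" using u by (auto simp: M_def)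
    have "(\<lambda>x\<in>\<Xi>. c \<cdot>\<^sub>m p x) z *\<^sub>v v = c \<cdot>\<^sub>v u"
      using smult_mat_mult_vec[OF pz[OF p(1)] v] z\<Xi> p by simp
    then show ?thesis by (rule mem[OF nc_algebraD(3)[OF alg p(1), of c]])
  qed
  have inv: "q z *\<^sub>v u \<in> M" if q: "q \<in> A" and u: "u \<in> M" for q u
  proof -
    obtain p where p: "p \<in> A" "u = p z *\<^sub>v v" using u by (auto simp: M_def)
    have "(\<lambda>x\<in>\<Xi>. q x * p x) z *\<^sub>v v = q z *\<^sub>v u"
      using assoc_mult_mat_vec[OF pz[OF q] pz[OF p(1)] v] z\<Xi> p by simp
    then show ?thesis by (rule mem[OF nc_algebraD(4)[OF alg q p(1)]])
  qed
  obtain P where P: "P \<in> carrier_mat n n"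
    and Pherm: "\<And>a b. a < n \<Longrightarrow> b < n \<Longrightarrow> P $$ (b, a) = cnj (P $$ (a, b))"
    and Pfix: "\<And>u. u \<in> M \<Longrightarrow> P *\<^sub>v u = u" and Pran: "\<And>u. u \<in> carrier_vec n \<Longrightarrow> P *\<^sub>v u \<in> M"
    using orthogonal_projection_exists[OF Mc zero add smult] by blast
  have PP: "P * P = P"
    by (rule eq_mat_mult_vecI[of _ n n]) (use P Pfix Pran in \<open>auto simp: assoc_mult_mat_vec[OF P P]\<close>)
  \<comment> \<open>Invariance of \<open>M\<close> as a matrix identity: the corner of
    \<open>q z\<close> from \<open>M\<close> to its orthogonal complement is zero.\<close>
  have PqP: "P * (q z * P) = q z * P" if q: "q \<in> A" for q
  proof (rule eq_mat_mult_vecI[of _ n n])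
    fix u :: "complex vec" assume u: "u \<in> carrier_vec n"
    have qu: "(q z * P) *\<^sub>v u = q z *\<^sub>v (P *\<^sub>v u)" by (rule assoc_mult_mat_vec[OF pz[OF q] P u])
    have "(P * (q z * P)) *\<^sub>v u = P *\<^sub>v ((q z * P) *\<^sub>v u)"
      by (rule assoc_mult_mat_vec[OF P mult_carrier_mat[OF pz[OF q] P] u])
    then show "(P * (q z * P)) *\<^sub>v u = (q z * P) *\<^sub>v u"
      unfolding qu using Pfix[OF inv[OF q Pran[OF u]]] by simp
  qed (use P pz[OF q] in auto)
  define L where "L = one_plus_smult n P"
  have L: "L c \<in> carrier_mat n n" for c using P by (simp add: L_def)
  have LL: "L c * L d = L (c + d + c * d)" for c d
    unfolding L_def by (rule one_plus_smult_mult[OF P PP])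
  have L0: "L 0 = 1\<^sub>m n" unfolding L_def by (rule one_plus_smult_zero[OF P])
  have Lv: "L c *\<^sub>v u = u + c \<cdot>\<^sub>v (P *\<^sub>v u)" if "u \<in> carrier_vec n" for c u
    unfolding L_def by (rule one_plus_smult_mult_vec[OF P that])
  \<comment> \<open>For t at least 1 let \<open>S\<close> scale \<open>M\<close> by t and fix its
    orthogonal complement. The point similar to z through \<open>S\<close> stays in the domain of f,
    and its value under f is the corresponding conjugate of \<open>f z\<close>.\<close>
  have dilate: "\<exists>y\<in>?D. f y \<in> carrier_mat n n \<and> f y = L (of_real (1 / t) - 1) * (f z * L (of_real t - 1))"
    if t: "1 \<le> t" for t :: real
  proof -
    define s where "s = 1 / t"
    have s: "0 \<le> s" "s \<le> 1" "s * t = 1" using t by (simp_all add: s_def)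
    define S T where "S = L (of_real t - 1)" and "T = L (of_real s - 1)"
    have Sc: "S \<in> carrier_mat n n" and Tc: "T \<in> carrier_mat n n" by (simp_all add: S_def T_def L)
    have st: "complex_of_real s * of_real t = 1" using s(3) by (metis of_real_1 of_real_mult)
    have "(of_real t - 1) + (of_real s - 1) + (of_real t - 1) * (of_real s - 1) = (0 :: complex)"
      "(of_real s - 1) + (of_real t - 1) + (of_real s - 1) * (of_real t - 1) = (0 :: complex)"
      using st by (simp_all add: algebra_simps)
    then have ST: "S * T = 1\<^sub>m n" and TS: "T * S = 1\<^sub>m n"
      by (simp_all only: S_def T_def LL L0)
    obtain y where y: "y \<in> \<Xi>" "y \<in> carrier_mat n n" and eq: "left_act scale S y = right_act scale z S"
      by (rule full_nc_set_similar[OF vs full z\<Xi> zc Sc Tc ST TS])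
    \<comment> \<open>\<open>L (-2)\<close> is the reflection 1 - 2P, which is -1 on
      \<open>M\<close> and 1 on the complement.\<close>
    have W: "L (-2) \<in> carrier_mat n n" by (rule L)
    have WW: "L (-2) * L (-2) = 1\<^sub>m n" by (simp add: LL L0)
    have Wherm: "L (-2) $$ (b, a) = cnj (L (-2) $$ (a, b))" if "a < n" "b < n" for a b
      using that P Pherm[OF that] by (auto simp: L_def one_plus_smult_def)
    define c where "c = op_norm_mat (eval_matrix Q z)"
    have c: "0 \<le> c" "c < 1" using z op_norm_mat_nonneg by (auto simp: c_def basic_free_set_def)
    have QA: "Q $$ (i, j) \<in> A" if "i < dim_row Q" "j < dim_col Q" for i j
      using Q that by (auto simp: matrix_over_def)
    have "block_norm_le (\<lambda>i j. (Q $$ (i, j)) y) (dim_row Q) (dim_col Q) n c"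
    \<comment> \<open>Conjugation by the reflection keeps the diagonal blocks and changes the sign
      of the remaining corner. The weights have sum 1 and difference s, so the average multiplies
      that corner by s. They are nonnegative since s is at most 1.\<close>
    proof (rule block_norm_le_convex_conj[OF _ _ W WW Wherm, where \<alpha> = "(1 + s) / 2" and \<beta> = "(1 - s) / 2"])
      show "block_norm_le (\<lambda>i j. (Q $$ (i, j)) z) (dim_row Q) (dim_col Q) n c"
        using op_norm_eval_matrix_le_iff[OF c(1) _ n, of z Q] zc by (simp add: c_def)
      fix i j assume ij: "i < dim_row Q" "j < dim_col Q"
      define q B where "q = Q $$ (i, j)" and "B = q z"
      have q: "q \<in> A" using QA[OF ij] by (simp add: q_def)
      have B: "B \<in> carrier_mat n n" using pz[OF q] by (simp add: B_def)
      then show "(Q $$ (i, j)) z \<in> carrier_mat n n" by (simp add: B_def q_def)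
      have PBP: "P * (B * P) = B * P" using PqP[OF q] by (simp add: B_def)
      have "q y = T * (B * S)"
        unfolding B_def by (rule nc_function_similar[OF pnc[OF q] y z\<Xi> zc Sc Tc TS eq])
      also have "\<dots> = B + ((of_real t - 1 + (of_real s - 1) * (of_real t - 1)) \<cdot>\<^sub>m (B * P) + (of_real s - 1) \<cdot>\<^sub>m (P * B))"
        unfolding S_def T_def L_def by (rule one_plus_smult_sandwich[OF P B PBP])
      also have "of_real t - 1 + (of_real s - 1) * (of_real t - 1) = 1 - complex_of_real s"
        using st by (simp add: algebra_simps)
      \<comment> \<open>P B - B P is the corner of \<open>B\<close> from the complement into
        \<open>M\<close>, so the left side is \<open>B\<close> with this corner multiplied by
        s.\<close>
      also have "B + ((1 - of_real s) \<cdot>\<^sub>m (B * P) + (of_real s - 1) \<cdot>\<^sub>m (P * B))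
          = of_real ((1 + s) / 2) \<cdot>\<^sub>m B + of_real ((1 - s) / 2) \<cdot>\<^sub>m (L (-2) * (B * L (-2)))"
      proof -
        have "B + ((1 - of_real s) \<cdot>\<^sub>m Y + (of_real s - 1) \<cdot>\<^sub>m X)
            = of_real ((1 + s) / 2) \<cdot>\<^sub>m B + of_real ((1 - s) / 2) \<cdot>\<^sub>m (B + ((-2 + (-2) * (-2)) \<cdot>\<^sub>m Y + (-2) \<cdot>\<^sub>m X))"
          if "X \<in> carrier_mat n n" "Y \<in> carrier_mat n n" for X Y
          by (rule eq_matI) (use B that in \<open>auto simp: field_simps\<close>)
        from this[OF mult_carrier_mat[OF P B] mult_carrier_mat[OF B P]]
        show ?thesis unfolding L_def one_plus_smult_sandwich[OF P B PBP] .
      qed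
      finally show "(Q $$ (i, j)) y = of_real ((1 + s) / 2) \<cdot>\<^sub>m (Q $$ (i, j)) z
          + of_real ((1 - s) / 2) \<cdot>\<^sub>m (L (-2) * ((Q $$ (i, j)) z * L (-2)))"
        by (simp add: q_def B_def)
    qed (use s in \<open>simp_all add: field_simps\<close>)
    then have "op_norm_mat (eval_matrix Q y) \<le> c"
      using op_norm_eval_matrix_le_iff[OF c(1) _ n, of y Q] y by simp
    then have yD: "y \<in> ?D" using y c by (simp add: basic_free_set_def)
    have "f y = T * (f z * S)" by (rule nc_function_similar[OF fnc yD y(2) z zc Sc Tc TS eq])
    moreover have "f y \<in> carrier_mat n n" using nc_function_carrier[OF fnc yD sp[OF y(1)]] y(2) by simp
    ultimately show ?thesis using yD unfolding S_def T_def s_def by blast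
  qed
  obtain C where C: "op_norm_mat (f y) \<le> C" if "y \<in> ?D" for y
    using f by (auto simp: H_infty_def bounded_graded_def bdd_above_def)
  define u where "u = f z *\<^sub>v v"
  have u: "u \<in> carrier_vec n" using fz v by (auto simp: u_def)
  \<comment> \<open>A bound for (1 - P) applied to \<open>f y\<close> v that does not depend on the
    dilation.\<close>
  define K where "K = op_norm_mat (L (-1)) * (C * l2_norm_vec v)"
  have bound: "t * l2_norm_vec (L (-1) *\<^sub>v u) \<le> K" if t: "1 \<le> t" for t
  proof -
    obtain y where y: "y \<in> ?D" "f y \<in> carrier_mat n n" "f y = L (of_real (1 / t) - 1) * (f z * L (of_real t - 1))"
      using dilate[OF t] by blast
    let ?t = "complex_of_real t" and ?s = "complex_of_real (1 / t)"
    \<comment> \<open>v lies in \<open>M\<close>, so the dilation multiplies it by t.\<close>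
    have Sv: "L (?t - 1) *\<^sub>v v = ?t \<cdot>\<^sub>v v"
      unfolding Lv[OF v] Pfix[OF vM] using v by (intro eq_vecI) (auto simp: algebra_simps)
    have "f y *\<^sub>v v = L (?s - 1) *\<^sub>v (f z *\<^sub>v (L (?t - 1) *\<^sub>v v))"
      unfolding y(3) using assoc_mult_mat_vec[OF L mult_carrier_mat[OF fz L] v] assoc_mult_mat_vec[OF fz L v] by simp
    also have "\<dots> = ?t \<cdot>\<^sub>v (L (?s - 1) *\<^sub>v u)"
      unfolding Sv u_def mult_mat_vec[OF fz v] by (rule mult_mat_vec[OF L]) (use fz v in auto)
    finally have fyv: "f y *\<^sub>v v = ?t \<cdot>\<^sub>v (L (?s - 1) *\<^sub>v u)" .
    have "L (-1) *\<^sub>v (f y *\<^sub>v v) = ?t \<cdot>\<^sub>v (L (-1) *\<^sub>v (L (?s - 1) *\<^sub>v u))"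
      unfolding fyv by (rule mult_mat_vec[OF L mult_mat_vec_carrier[OF L u]])
    \<comment> \<open>1 - P vanishes on \<open>M\<close>, where the inverse dilation scales, and the
      inverse dilation is the identity on the complement. So the factor 1/t is lost and t
      remains.\<close>
    also have "L (-1) *\<^sub>v (L (?s - 1) *\<^sub>v u) = L (-1) *\<^sub>v u"
      unfolding assoc_mult_mat_vec[OF L L u, symmetric] LL by simp
    finally have "t * l2_norm_vec (L (-1) *\<^sub>v u) = l2_norm_vec (L (-1) *\<^sub>v (f y *\<^sub>v v))"
      using t by (simp add: l2_norm_vec_smult)
    also have "\<dots> \<le> op_norm_mat (L (-1)) * l2_norm_vec (f y *\<^sub>v v)"
      by (rule op_norm_mat_bound) (use L[of "-1"] y(2) v in auto)
    also have "\<dots> \<le> op_norm_mat (L (-1)) * (op_norm_mat (f y) * l2_norm_vec v)"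
      by (intro mult_left_mono op_norm_mat_bound op_norm_mat_nonneg) (use y(2) v in auto)
    also have "\<dots> \<le> K"
      unfolding K_def by (intro mult_left_mono mult_right_mono C y(1) op_norm_mat_nonneg l2_norm_vec_nonneg)
    finally show ?thesis .
  qed
  have "l2_norm_vec (L (-1) *\<^sub>v u) = 0"
  proof (rule ccontr)
    let ?l = "l2_norm_vec (L (-1) *\<^sub>v u)"
    assume "?l \<noteq> 0"
    then have l: "0 < ?l" using l2_norm_vec_nonneg[of "L (-1) *\<^sub>v u"] by simp
    \<comment> \<open>Large enough to push t times the norm to K + 1, and at least 1 as the bound
      requires.\<close>
    define t where "t = max 1 ((K + 1) / ?l)"
    have "K + 1 = (K + 1) / ?l * ?l" using l by simp
    also have "\<dots> \<le> t * ?l" using l by (intro mult_right_mono) (auto simp: t_def)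
    also have "\<dots> \<le> K" by (rule bound) (simp add: t_def)
    finally show False by simp
  qed
  then have "L (-1) *\<^sub>v u = 0\<^sub>v n" using l2_norm_vec_eq_0[of "L (-1) *\<^sub>v u"] L[of "-1"] by auto
  then have R0: "u + (-1) \<cdot>\<^sub>v (P *\<^sub>v u) = 0\<^sub>v n" unfolding Lv[OF u] .
  have "u = P *\<^sub>v u"
  proof (rule eq_vecI)
    fix i assume "i < dim_vec (P *\<^sub>v u)"
    then have i: "i < n" using P by simp
    have "(u + (-1) \<cdot>\<^sub>v (P *\<^sub>v u)) $ i = 0" using R0 i by simp
    moreover have "(u + (-1) \<cdot>\<^sub>v (P *\<^sub>v u)) $ i = u $ i - (P *\<^sub>v u) $ i" using i u P by simp
    ultimately show "u $ i = (P *\<^sub>v u) $ i" by simp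
  qed (use u P in auto)
  then have "u \<in> M" using Pran[OF u] by simp
  then show ?thesis by (auto simp: M_def u_def)
qed

lemma H_infty_agrees_at_point:
  assumes f: "f \<in> H_infty scale (basic_free_set \<Xi> Q)" and z: "z \<in> basic_free_set \<Xi> Q"
  shows "\<exists>p\<in>A. f z = p z"
proof -
  let ?D = "basic_free_set \<Xi> Q"
  have D: "nc_set ?D" by (rule nc_set_basic_free_set[OF vs nc alg Q])
  have fnc: "nc_function scale ?D f" using f by (simp add: H_infty_def)
  have z\<Xi>: "z \<in> \<Xi>" using z by (simp add: basic_free_set_def)
  define n where "n = dim_row z"
  have sp: "z \<in> nc_space" using nc z\<Xi> by (auto simp: nc_set_def)
  then have zc: "z \<in> carrier_mat n n" by (auto simp: nc_space_def n_def)
  have fz: "f z \<in> carrier_mat n n" using nc_function_carrier[OF fnc z sp] by (simp add: n_def)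
  \<comment> \<open>One p serves all basis vectors at once, because it serves their stack. There are
    n + 1 copies, and the extra vector \<open>unit_vec n n\<close> is zero.\<close>
  obtain p where p: "p \<in> A" and eq: "f (copies z n) *\<^sub>v stack (unit_vec n) n = p (copies z n) *\<^sub>v stack (unit_vec n) n"
    using H_infty_agrees_on_vec[OF f copies_mem[OF D z] copies_carrier[OF zc] stack_carrier[of "unit_vec n" n n]]
    by auto
  have pnc: "nc_function scale \<Xi> p" by (rule nc_algebraD(1)[OF alg p])
  have pz: "p z \<in> carrier_mat n n" using nc_function_carrier[OF pnc z\<Xi> sp] by (simp add: n_def)
  have st: "stack (\<lambda>i. f z *\<^sub>v unit_vec n i) n = stack (\<lambda>i. p z *\<^sub>v unit_vec n i) n"
    using eq unfolding nc_function_copies[OF vs fnc D z] nc_function_copies[OF vs pnc nc z\<Xi>]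
    by (simp add: copies_mult_stack[OF fz] copies_mult_stack[OF pz])
  have "f z = p z"
  proof (rule eq_matI)
    fix i j assume "i < dim_row (p z)" "j < dim_col (p z)"
    then have ij: "i < n" "j < n" using pz by auto
    have "f z *\<^sub>v unit_vec n j = p z *\<^sub>v unit_vec n j"
      by (rule stack_inject[OF st, where n = n]) (use ij fz pz in auto)
    then have "(f z *\<^sub>v unit_vec n j) $ i = (p z *\<^sub>v unit_vec n j) $ i" by simp
    then show "f z $$ (i, j) = p z $$ (i, j)" using ij fz pz by simp
  qed (use fz pz in auto)
  then show ?thesis using p by blast
qed

text \<open>Fix p with f = p at l. The element q that interpolates at the direct sum of l and x
  depends on x, but p - q vanishes at l and therefore at every x in the closure, so f x = q x = p
  x.\<close>

lemma H_infty_agrees_on_zariski_closure: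
  assumes f: "f \<in> H_infty scale (basic_free_set \<Xi> Q)" and l: "l \<in> basic_free_set \<Xi> Q"
  shows "\<exists>p\<in>A. \<forall>x\<in>zariski_closure \<Xi> A l \<inter> basic_free_set \<Xi> Q. f x = p x"
proof -
  let ?D = "basic_free_set \<Xi> Q"
  have D: "nc_set ?D" by (rule nc_set_basic_free_set[OF vs nc alg Q])
  have fnc: "nc_function scale ?D f" using f by (simp add: H_infty_def)
  have sub: "?D \<subseteq> \<Xi>" by (auto simp: basic_free_set_def)
  obtain p where p: "p \<in> A" "f l = p l" using H_infty_agrees_at_point[OF f l] by blast
  have "f x = p x" if "x \<in> zariski_closure \<Xi> A l" and x: "x \<in> ?D" for x
  proof -
    have l\<Xi>: "l \<in> \<Xi>" and x\<Xi>: "x \<in> \<Xi>" using l x sub by auto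
    have "direct_sum_mat l x \<in> ?D" using D l x by (auto simp: nc_set_def)
    then obtain q where q: "q \<in> A" "f (direct_sum_mat l x) = q (direct_sum_mat l x)"
      using H_infty_agrees_at_point[OF f] by blast
    have car: "g y \<in> carrier_mat (dim_row y) (dim_row y)" if "g \<in> A" "y \<in> \<Xi>" for g y
      using nc that by (intro nc_function_carrier[OF nc_algebraD(1)[OF alg]]) (auto simp: nc_set_def)
    have fcar: "f y \<in> carrier_mat (dim_row y) (dim_row y)" if "y \<in> ?D" for y
      using nc that sub by (intro nc_function_carrier[OF fnc]) (auto simp: nc_set_def)
    have "direct_sum_mat (f l) (f x) = direct_sum_mat (q l) (q x)"
      using q(2) nc_function_direct_sum[OF vs fnc D l x]
        nc_function_direct_sum[OF vs nc_algebraD(1)[OF alg q(1)] nc l\<Xi> x\<Xi>] by simp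
    then have "f l = q l \<and> f x = q x"
      by (rule direct_sum_mat_inject[OF fcar[OF l] car[OF q(1) l\<Xi>] fcar[OF x] car[OF q(1) x\<Xi>]])
    then have fq: "f l = q l" "f x = q x" by auto
    define d where "d = (\<lambda>x\<in>\<Xi>. p x + (\<lambda>x\<in>\<Xi>. (-1) \<cdot>\<^sub>m q x) x)"
    have d: "d \<in> A" unfolding d_def by (intro nc_algebraD[OF alg] p(1) q(1))
    have "d l = 0\<^sub>m (dim_row l) (dim_row l)"
      using l\<Xi> p(2) fq(1) car[OF q(1) l\<Xi>] by (intro eq_matI) (auto simp: d_def)
    then have "d x = 0\<^sub>m (dim_row x) (dim_row x)"
      using that(1) d by (auto simp: zariski_closure_def vanishing_ideal_def)
    then have dx: "p x + (-1) \<cdot>\<^sub>m q x = 0\<^sub>m (dim_row x) (dim_row x)" using x\<Xi> by (simp add: d_def)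
    have "p x = q x"
    proof (rule eq_matI)
      fix i j assume "i < dim_row (q x)" "j < dim_col (q x)"
      then have ij: "i < dim_row x" "j < dim_row x" using car[OF q(1) x\<Xi>] by auto
      have "(p x + (-1) \<cdot>\<^sub>m q x) $$ (i, j) = p x $$ (i, j) - q x $$ (i, j)"
        using ij car[OF q(1) x\<Xi>] by auto
      then show "p x $$ (i, j) = q x $$ (i, j)" using ij by (simp add: dx)
    qed (use car[OF q(1) x\<Xi>] car[OF p(1) x\<Xi>] in auto)
    then show ?thesis using fq by simp
  qed
  then show ?thesis using p(1) by blast
qed

end

end

section \<open>Equivalence of the three conditions\<close>

theorem theorem3p1:
  fixes scale :: "complex \<Rightarrow> 'v::ab_group_add \<Rightarrow> 'v"
    and \<Xi> :: "'v mat set"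
    and A :: "('v mat \<Rightarrow> complex mat) set"
    and Q :: "('v mat \<Rightarrow> complex mat) mat"
    and f :: "'v mat \<Rightarrow> complex mat"
  assumes "vector_space scale"
    and "full_nc_set scale \<Xi>"
    and "nc_algebra scale \<Xi> A"
    and "nc_unit \<Xi> \<in> A"
    and "matrix_over A Q"
    and "bounded_graded (basic_free_set \<Xi> Q) f"
  shows "(f \<in> H_infty scale (basic_free_set \<Xi> Q) \<longleftrightarrow>
           (\<forall>l\<in>basic_free_set \<Xi> Q. \<exists>p\<in>A.
              \<forall>x\<in>zariski_closure \<Xi> A l \<inter> basic_free_set \<Xi> Q. f x = p x)) \<and>
         (f \<in> H_infty scale (basic_free_set \<Xi> Q) \<longleftrightarrow>
           (\<forall>K. K \<subseteq> basic_free_set \<Xi> Q \<and> nc_set K \<and> compactin (free_topology \<Xi> A) K \<longrightarrow>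
              (\<exists>p\<in>A. \<forall>x\<in>K. f x = p x)))"
proof -
  let ?D = "basic_free_set \<Xi> Q"
  let ?one = "f \<in> H_infty scale ?D"
  let ?two = "\<forall>l\<in>?D. \<exists>p\<in>A. \<forall>x\<in>zariski_closure \<Xi> A l \<inter> ?D. f x = p x"
  let ?three = "\<forall>K. K \<subseteq> ?D \<and> nc_set K \<and> compactin (free_topology \<Xi> A) K \<longrightarrow> (\<exists>p\<in>A. \<forall>x\<in>K. f x = p x)"
  note vs = assms(1) and full = assms(2) and alg = assms(3) and unit = assms(4) and Q = assms(5)
  have nc: "nc_set \<Xi>" using full by (simp add: full_nc_set_def)
  have D: "nc_set ?D" by (rule nc_set_basic_free_set[OF vs nc alg Q])
  have sub: "?D \<subseteq> \<Xi>" by (auto simp: basic_free_set_def)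
  \<comment> \<open>An intertwining involves only two points, so it is enough that f agrees with
    some element of \<open>A\<close> on each pair. Gradedness and boundedness are given.\<close>
  have one_if: ?one if agree: "\<And>x y. x \<in> ?D \<Longrightarrow> y \<in> ?D \<Longrightarrow> \<exists>p\<in>A. f x = p x \<and> f y = p y"
  proof -
    have "nc_function scale ?D f"
      unfolding nc_function_def
    proof (intro conjI allI ballI impI)
      show "graded_on ?D f" using assms(6) by (simp add: bounded_graded_def)
      fix n m x y \<alpha>
      assume xy: "x \<in> nc_level ?D n" "y \<in> nc_level ?D m" and \<alpha>: "\<alpha> \<in> carrier_mat m n"
        "left_act scale \<alpha> x = right_act scale y \<alpha>"
      then obtain p where p: "p \<in> A" "f x = p x" "f y = p y" using agree by (auto simp: nc_level_def)
      show "\<alpha> * f x = f y * \<alpha>"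
        unfolding p(2,3)
        by (rule nc_functionD[OF nc_algebraD(1)[OF alg p(1)] _ _ _ _ \<alpha>]) (use xy sub in \<open>auto simp: nc_level_def\<close>)
    qed
    then show ?one using assms(6) by (simp add: H_infty_def)
  qed
  have 12: ?two if ?one
    using H_infty_agrees_on_zariski_closure[OF vs full alg unit Q that] by blast
  have 21: ?one if two: ?two
  proof (rule one_if)
    fix x y assume xy: "x \<in> ?D" "y \<in> ?D"
    \<comment> \<open>An element of \<open>A\<close> that vanishes at the direct sum vanishes at
      both summands, so the closure of this point contains x and y.\<close>
    let ?l = "direct_sum_mat x y"
    have xy\<Xi>: "x \<in> \<Xi>" "y \<in> \<Xi>" using xy sub by auto
    have l: "?l \<in> ?D" using D xy by (auto simp: nc_set_def)
    have "p x = 0\<^sub>m (dim_row x) (dim_row x) \<and> p y = 0\<^sub>m (dim_row y) (dim_row y)"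
      if p: "p \<in> A" "p ?l = 0\<^sub>m (dim_row ?l) (dim_row ?l)" for p
    proof (rule direct_sum_mat_inject)
      have "p ?l = direct_sum_mat (p x) (p y)"
        by (rule nc_function_direct_sum[OF vs nc_algebraD(1)[OF alg p(1)] nc xy\<Xi>])
      moreover have "dim_col x = dim_row x" "dim_col y = dim_row y"
        using nc xy\<Xi> by (auto simp: nc_set_def nc_space_def)
      then have "0\<^sub>m (dim_row ?l) (dim_row ?l) = direct_sum_mat (0\<^sub>m (dim_row x) (dim_row x)) (0\<^sub>m (dim_row y) (dim_row y) :: complex mat)"
        by (intro eq_matI) (auto simp: direct_sum_mat_def)
      ultimately show "direct_sum_mat (p x) (p y) = direct_sum_mat (0\<^sub>m (dim_row x) (dim_row x)) (0\<^sub>m (dim_row y) (dim_row y))"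
        using p(2) by simp
    qed (use nc xy\<Xi> in \<open>auto simp: nc_set_def intro!: nc_function_carrier[OF nc_algebraD(1)[OF alg p(1)]]\<close>)
    then have "x \<in> zariski_closure \<Xi> A ?l" "y \<in> zariski_closure \<Xi> A ?l"
      using xy\<Xi> by (auto simp: zariski_closure_def vanishing_ideal_def)
    then show "\<exists>p\<in>A. f x = p x \<and> f y = p y" using two l xy by blast
  qed
  have 13: ?three if ?one
  proof (intro allI impI)
    fix K assume K: "K \<subseteq> ?D \<and> nc_set K \<and> compactin (free_topology \<Xi> A) K"
    show "\<exists>p\<in>A. \<forall>x\<in>K. f x = p x"
    proof (cases "K = {}")
      case True
      then show ?thesis using unit by auto
    next
      case False
      then obtain l where "l \<in> K" "K \<subseteq> zariski_closure \<Xi> A l"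
        using compact_nc_set_subset_zariski_closure[OF vs full alg, of K] K sub by blast
      then show ?thesis using 12[OF that] K by blast
    qed
  qed
  have 31: ?one if three: ?three
  proof (rule one_if)
    fix x y assume xy: "x \<in> ?D" "y \<in> ?D"
    \<comment> \<open>The nc set generated by the pair is a compact set on which the third condition
      can be tested.\<close>
    have "compactin (free_topology \<Xi> A) (nc_hull {x, y})"
      by (rule compactin_nc_hull_pair[OF vs full alg xy Q])
    moreover have "nc_hull {x, y} \<subseteq> ?D" "nc_set (nc_hull {x, y})"
      using nc_hull_subset[OF D, of "{x, y}"] nc_set_nc_hull[OF D, of "{x, y}"] xy by auto
    ultimately obtain p where "p \<in> A" "\<forall>w\<in>nc_hull {x, y}. f w = p w" using three by blast
    then show "\<exists>p\<in>A. f x = p x \<and> f y = p y" by (auto intro: nc_hull.base)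
  qed
  show ?thesis using 12 21 13 31 by blast
qed

end
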